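(* Let $\alpha>-1$, $1<p\le q<\infty$ and $0\le\gamma<2+\alpha$. Let $\mu$ be a positive measure and $\sigma$ a weight on $\mathcal H$ with $\sigma\in\mathcal B_{\infty,\alpha}$. The following are equivalent: (i) there is $C_1>0$ such that for every $f\in L^p(\mathcal H,\sigma dV_\alpha)$, $$\left(\int_{\mathcal H}\big(\mathcal M_{\alpha,\gamma}(\sigma f)\big)^q d\mu\right)^{1/q}\le C_1\|f\|_{p,\sigma,\alpha};$$ (ii) $$[\sigma,\mu]_{p,q,\alpha,\gamma}:=\sup_{I\subset\mathbb R}|Q_I|_\alpha^{-q(1-\frac{\gamma}{2+\alpha})}\mu(Q_I)\,|Q_I|_{\sigma,\alpha}^{q/p'}<\infty.$$ Moreover, there is a constant $C$ depending only on $p,q,\alpha,\gamma$ such that for all $f$, $$\|\mathcal M_{\alpha,\gamma}(\sigma f)\|_{L^q(d\mu)}\le C\,([\sigma,\mu]_{p,q,\alpha,\gamma})^{1/q}[\sigma]_{\mathcal B_{\infty,\alpha}}^{1/p}\|f\|_{p,\sigma,\alpha}.$$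
   Context: $\mathcal H=\{x+iy:x\in\mathbb R,\ y>0\}$; for $\alpha>-1$, $dV_\alpha(x+iy)=y^\alpha dx\,dy$. A weight is a nonnegative locally integrable function on $\mathcal H$; $\|f\|_{p,\sigma,\alpha}=(\int_{\mathcal H}|f|^p\sigma\,dV_\alpha)^{1/p}$. For $E\subset\mathcal H$, $|E|_{\sigma,\alpha}=\int_E\sigma\,dV_\alpha$ and $|E|_\alpha=\int_EdV_\alpha$. $p'$ is the conjugate exponent. For an interval $I\subset\mathbb R$, $Q_I=\{x+iy:x\in I,\ 0<y<|I|\}$. For $0\le\gamma<2+\alpha$, $\mathcal M_{\alpha,\gamma}f(z)=\sup\{|I|^{-(2+\alpha-\gamma)}\int_{Q_I}|f|\,dV_\alpha:\ I\subset\mathbb R\text{ an interval with } z\in Q_I\}$, and $\mathcal M_\alpha=\mathcal M_{\alpha,0}$. A weight $\sigma$ belongs to $\mathcal B_{\infty,\alpha}$ if $[\sigma]_{\mathcal B_{\infty,\alpha}}:=\sup_{I\subset\mathbb R}\frac{1}{|Q_I|_{\sigma,\alpha}}\int_{Q_I}\mathcal M_\alpha(\sigma\chi_{Q_I})\,dV_\alpha<\infty$. *)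

theory Defs
  imports "HOL-Analysis.Analysis"
begin

definition UHP :: "complex set" where
  "UHP = {z. Im z > 0}"

definition Valpha :: "real \<Rightarrow> complex measure" where
  "Valpha \<alpha> = density lborel (\<lambda>z. indicator UHP z * ennreal (Im z powr \<alpha>))"

definition epowr :: "ennreal \<Rightarrow> real \<Rightarrow> ennreal" where
  "epowr x r = (if x = \<infinity> then \<infinity> else ennreal (enn2real x powr r))"

definition Qbox :: "real \<Rightarrow> real \<Rightarrow> complex set" where
  "Qbox a b = {z. a \<le> Re z \<and> Re z \<le> b \<and> 0 < Im z \<and> Im z < b - a}"

definition is_weight :: "(complex \<Rightarrow> real) \<Rightarrow> bool" where
  "is_weight \<sigma> \<longleftrightarrow> (\<forall>z\<in>UHP. 0 \<le> \<sigma> z) \<and> \<sigma> \<in> borel_measurable borel \<and>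
     (\<forall>K. compact K \<and> K \<subseteq> UHP \<longrightarrow> set_integrable lborel K \<sigma>)"

definition wmeas :: "(complex \<Rightarrow> real) \<Rightarrow> real \<Rightarrow> complex set \<Rightarrow> ennreal" where
  "wmeas \<sigma> \<alpha> E = (\<integral>\<^sup>+ z. ennreal (\<sigma> z) * indicator E z \<partial>Valpha \<alpha>)"

definition wnorm :: "real \<Rightarrow> (complex \<Rightarrow> real) \<Rightarrow> real \<Rightarrow> (complex \<Rightarrow> complex) \<Rightarrow> ennreal" where
  "wnorm p \<sigma> \<alpha> f = epowr (\<integral>\<^sup>+ z. ennreal (norm (f z) powr p * \<sigma> z) \<partial>Valpha \<alpha>) (1 / p)"

definition in_Lp :: "real \<Rightarrow> (complex \<Rightarrow> real) \<Rightarrow> real \<Rightarrow> (complex \<Rightarrow> complex) \<Rightarrow> bool" where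
  "in_Lp p \<sigma> \<alpha> f \<longleftrightarrow> f \<in> borel_measurable borel \<and> wnorm p \<sigma> \<alpha> f < \<infinity>"

definition Mfrac :: "real \<Rightarrow> real \<Rightarrow> (complex \<Rightarrow> complex) \<Rightarrow> complex \<Rightarrow> ennreal" where
  "Mfrac \<alpha> \<gamma> f z = (SUP (a, b) \<in> {(a, b). a < b \<and> z \<in> Qbox a b}.
      ennreal ((b - a) powr (-(2 + \<alpha> - \<gamma>))) *
      (\<integral>\<^sup>+ w. ennreal (norm (f w)) * indicator (Qbox a b) w \<partial>Valpha \<alpha>))"

text \<open>B_infinity constant. When |Q_I|_{sigma,alpha} = infinity the quotient is taken to be
  infinity (then also the numerator is infinite).\<close>
definition Binf_const :: "(complex \<Rightarrow> real) \<Rightarrow> real \<Rightarrow> ennreal" where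
  "Binf_const \<sigma> \<alpha> = (SUP (a, b) \<in> {(a, b). a < b}.
      (if wmeas \<sigma> \<alpha> (Qbox a b) = \<infinity> then \<infinity> else
       (\<integral>\<^sup>+ z. Mfrac \<alpha> 0 (\<lambda>w. complex_of_real (\<sigma> w * indicator (Qbox a b) w)) z
              * indicator (Qbox a b) z \<partial>Valpha \<alpha>) / wmeas \<sigma> \<alpha> (Qbox a b)))"

definition in_Binf :: "(complex \<Rightarrow> real) \<Rightarrow> real \<Rightarrow> bool" where
  "in_Binf \<sigma> \<alpha> \<longleftrightarrow> Binf_const \<sigma> \<alpha> < \<infinity>"

text \<open>The constant [sigma,mu]_{p,q,alpha,gamma}; p' = p/(p-1), so q/p' = q(p-1)/p.\<close>
definition sigma_mu_const ::
  "(complex \<Rightarrow> real) \<Rightarrow> complex measure \<Rightarrow> real \<Rightarrow> real \<Rightarrow> real \<Rightarrow> real \<Rightarrow> ennreal" where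
  "sigma_mu_const \<sigma> \<mu> p q \<alpha> \<gamma> = (SUP (a, b) \<in> {(a, b). a < b}.
      ennreal (enn2real (emeasure (Valpha \<alpha>) (Qbox a b)) powr (- q * (1 - \<gamma> / (2 + \<alpha>))))
      * emeasure \<mu> (Qbox a b)
      * epowr (wmeas \<sigma> \<alpha> (Qbox a b)) (q / (p / (p - 1))))"

definition wmul :: "(complex \<Rightarrow> real) \<Rightarrow> (complex \<Rightarrow> complex) \<Rightarrow> complex \<Rightarrow> complex" where
  "wmul \<sigma> f z = complex_of_real (\<sigma> z) * f z"

definition Mnorm_mu :: "complex measure \<Rightarrow> real \<Rightarrow> real \<Rightarrow> real \<Rightarrow> (complex \<Rightarrow> complex) \<Rightarrow> ennreal" where
  "Mnorm_mu \<mu> q \<alpha> \<gamma> g = epowr (\<integral>\<^sup>+ z. epowr (Mfrac \<alpha> \<gamma> g z) q \<partial>\<mu>) (1 / q)"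

end

theory Submission
  imports Defs
begin

text \<open>Every box \<open>Q\<^sub>I\<close> lies in a box of comparable size from one of two shifted dyadic grids, so
  \<open>(M f)\<^sup>q\<close> is dominated by the sum over all grid boxes of the \<open>q\<close>-th powers of the corresponding
  terms. No stopping-time selection of boxes is needed: the top halves of the grid boxes are
  disjoint and carry a fixed part of the volume, so the \<open>B\<^sub>\<infinity>\<close> condition says that the
  \<open>\<sigma>\<close>-masses of all dyadic boxes form a Carleson sequence with constant \<open>\<lesssim> [\<sigma>]\<close>. After the
  testing condition has removed \<open>\<mu>\<close>, the sum is controlled by a Carleson embedding theorem, which is
  proved by a Bellman function argument to keep the dependence on the Carleson constant linear.\<close>

section \<open>A Carleson embedding on dyadic trees\<close>

text \<open>Write \<open>s\<close> for the \<sigma>-mass of a box, \<open>F\<close> for the integral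
  of \<open>norm f\<close> over it against \<sigma>, and \<open>p'\<close> for the conjugate
  exponent. The testing condition bounds the term of a box by a multiple of
  \<open>F^q / s^(q/p')\<close>, and this equals \<open>((F/s)^p * s)^(q/p)\<close>. So it is enough
  to bound the sum of \<open>(F/s)^p * s\<close> over a grid by a multiple of
  \<open>Binf_const\<close> times the integral of \<open>norm f ^ p\<close>: since
  \<open>p \<le> q\<close>, the outer power \<open>q/p\<close> can be applied to the whole sum, and
  the final \<open>q\<close>-th root leaves the exponent \<open>1/p\<close> on
  \<open>Binf_const\<close>. A bound worse than linear in the Carleson constant would spoil exactly
  this exponent.\<close>

lemma Young_powr:
  fixes p x c :: real
  assumes "1 < p" "0 \<le> x" "0 \<le> c"
  shows "p * c powr (p - 1) * x \<le> x powr p + (p - 1) * c powr p"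
proof -
  have "x * c powr (p - 1) \<le> x powr p / p + (c powr (p - 1)) powr (p / (p - 1)) / (p / (p - 1))"
    by (rule Youngs_inequality) (use assms in \<open>auto simp: field_simps\<close>)
  also have "(c powr (p - 1)) powr (p / (p - 1)) = c powr p"
    using assms by (simp add: powr_powr)
  finally have "p * (x * c powr (p - 1)) \<le> p * (x powr p / p + c powr p / (p / (p - 1)))"
    using assms by (intro mult_left_mono) auto
  also have "\<dots> = x powr p + (p - 1) * c powr p"
    using assms by (simp add: field_simps)
  finally show ?thesis by (simp add: mult_ac)
qed

text \<open>Convexity of \<open>V powr (1 - p)\<close>: the graph lies above the tangent at
  \<open>U\<close>. For the denominators of the Bellman function before and after a node's own term
  is counted, the tangent term is the gain that pays for the node.\<close>

lemma powr_tangent: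
  fixes p U V :: real
  assumes "1 < p" "0 < V" "V \<le> U"
  shows "U powr (1 - p) + (p - 1) * U powr (- p) * (U - V) \<le> V powr (1 - p)"
proof -
  define x where "x = V / U"
  have U: "U > 0" using assms by linarith
  have x: "0 < x" using assms U by (simp add: x_def)
  \<comment> \<open>After scaling by \<open>U\<close>, this is \<open>ln x \<le> x - 1\<close>
    multiplied by the negative number \<open>1 - p\<close>, followed by
    \<open>1 + t \<le> exp t\<close>.\<close>
  have "1 + (1 - p) * (x - 1) \<le> x powr (1 - p)"
  proof -
    have "(1 - p) * (x - 1) \<le> (1 - p) * ln x"
      using assms ln_le_minus_one[OF x] by (simp add: mult_le_cancel_left)
    also have "1 + (1 - p) * ln x \<le> exp ((1 - p) * ln x)"
      by (rule exp_ge_add_one_self)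
    finally show ?thesis using x by (simp add: powr_def)
  qed
  then have "U powr (1 - p) * (1 + (1 - p) * (x - 1)) \<le> U powr (1 - p) * x powr (1 - p)"
    by (intro mult_left_mono) auto
  also have "U powr (1 - p) * x powr (1 - p) = V powr (1 - p)"
    using U assms x by (simp add: x_def powr_divide)
  also have "U powr (1 - p) = U * U powr (-p)"
    using U by (simp add: powr_mult_base)
  also have "U * U powr (-p) * (1 + (1 - p) * (x - 1))
    = U * U powr (-p) + (p - 1) * U powr (-p) * (U - V)"
    using U by (simp add: x_def field_simps)
  also have "U * U powr (-p) = U powr (1 - p)"
    using U by (simp add: powr_mult_base)
  finally show ?thesis .
qed

text \<open>A box is coded by the left end \<open>l\<close> and the length \<open>h\<close> of its
  interval. Stopping after \<open>n\<close> generations keeps real sums finite and gives an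
  induction; the monoid-valued form serves reals and extended reals alike.\<close>

fun tree_sum :: "(real \<Rightarrow> real \<Rightarrow> 'a::comm_monoid_add) \<Rightarrow> nat \<Rightarrow> real \<Rightarrow> real \<Rightarrow> 'a" where
  "tree_sum g 0 l h = 0"
| "tree_sum g (Suc n) l h = g l h + tree_sum g n l (h / 2) + tree_sum g n (l + h / 2) (h / 2)"

lemma tree_sum_nonneg:
  fixes g :: "real \<Rightarrow> real \<Rightarrow> 'a::ordered_comm_monoid_add"
  assumes "\<And>l h. 0 < h \<Longrightarrow> 0 \<le> g l h" "0 < h"
  shows "0 \<le> tree_sum g n l h"
  using assms(2)
  by (induction n arbitrary: l h) (auto intro!: add_nonneg_nonneg assms(1))

lemma tree_sum_mono:
  fixes g g' :: "real \<Rightarrow> real \<Rightarrow> 'a::ordered_comm_monoid_add"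
  assumes "\<And>l h. 0 < h \<Longrightarrow> g l h \<le> g' l h" "0 < h"
  shows "tree_sum g n l h \<le> tree_sum g' n l h"
  using assms(2) by (induction n arbitrary: l h) (auto intro!: add_mono assms(1))

lemma tree_sum_mult_left:
  fixes c :: "'a::{comm_monoid_add, semiring_0}"
  shows "tree_sum (\<lambda>l h. c * g l h) n l h = c * tree_sum g n l h"
  by (induction n arbitrary: l h) (auto simp: distrib_left)

lemma ennreal_tree_sum:
  assumes "\<And>l h. 0 < h \<Longrightarrow> 0 \<le> g l h" "0 < h"
  shows "ennreal (tree_sum g n l h) = tree_sum (\<lambda>l h. ennreal (g l h)) n l h"
  using assms(2)
proof (induction n arbitrary: l h)
  case (Suc n)
  have "0 < h / 2" using Suc.prems by simp
  then show ?case using Suc.prems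
    by (simp add: Suc.IH[symmetric] ennreal_plus assms(1) tree_sum_nonneg[OF assms(1)] add_nonneg_nonneg)
qed simp

lemma tree_sum_measurable:
  fixes \<rho> :: "real \<Rightarrow> real \<Rightarrow> 'b \<Rightarrow> ennreal"
  assumes [measurable]: "\<And>l h. \<rho> l h \<in> borel_measurable M"
  shows "(\<lambda>z. tree_sum (\<lambda>l h. \<rho> l h z) n l h) \<in> borel_measurable M"
  by (induction n arbitrary: l h) auto

lemma nn_integral_tree_sum:
  fixes \<rho> :: "real \<Rightarrow> real \<Rightarrow> 'b \<Rightarrow> ennreal"
  assumes [measurable]: "\<And>l h. \<rho> l h \<in> borel_measurable M"
  shows "(\<integral>\<^sup>+ z. tree_sum (\<lambda>l h. \<rho> l h z) n l h \<partial>M) = tree_sum (\<lambda>l h. \<integral>\<^sup>+ z. \<rho> l h z \<partial>M) n l h"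
proof (induction n arbitrary: l h)
  case (Suc n)
  have [measurable]: "(\<lambda>z. tree_sum (\<lambda>l h. \<rho> l h z) n l' h') \<in> borel_measurable M" for l' h'
    by (rule tree_sum_measurable) measurable
  show ?case by (simp add: nn_integral_add Suc.IH)
qed simp

lemma tree_sum_zero: "tree_sum (\<lambda>l h. 0) n l h = 0"
  by (induction n arbitrary: l h) auto

text \<open>The Bellman function is \<open>F\<^sup>p / (s + m)\<^sup>p\<^sup>-\<^sup>1\<close>, where \<open>m\<close> is the tree sum of \<open>s\<close> divided by \<open>A\<close>.
  It enters through its tangent planes, parametrised by the slope \<open>c\<close>: these are linear in
  \<open>(X, s, F)\<close>, hence additive over subtrees, and need no division by \<open>s\<close>.\<close>

lemma Carleson_embedding:
  fixes s F X :: "real \<Rightarrow> real \<Rightarrow> real" and p A :: real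
  defines "\<Psi> \<equiv> \<lambda>c l h. X l h + (p - 1) * c powr p * s l h - p * c powr (p - 1) * F l h"
  assumes p: "1 < p" and A: "0 < A"
    and s: "\<And>l h. 0 < h \<Longrightarrow> 0 \<le> s l h" and F: "\<And>l h. 0 < h \<Longrightarrow> 0 \<le> F l h"
    and F0: "\<And>l h. 0 < h \<Longrightarrow> s l h = 0 \<Longrightarrow> F l h = 0"
    and Carleson: "\<And>n l h. 0 < h \<Longrightarrow> tree_sum s n l h \<le> A * s l h"
    and \<Psi>_nonneg: "\<And>c l h. 0 \<le> c \<Longrightarrow> 0 < h \<Longrightarrow> 0 \<le> \<Psi> c l h"
    and \<Psi>_super: "\<And>c l h. 0 \<le> c \<Longrightarrow> 0 < h \<Longrightarrow> \<Psi> c l (h / 2) + \<Psi> c (l + h / 2) (h / 2) \<le> \<Psi> c l h"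
    and h: "0 < h"
  shows "tree_sum (\<lambda>l h. F l h powr p * s l h powr (1 - p)) n l h \<le> A * 2 powr p / (p - 1) * X l h"
proof -
  define g where "g = (\<lambda>l h. F l h powr p * s l h powr (1 - p))"
  \<comment> \<open>One step gains \<open>(p - 1) * U powr (- p) * (s l h / A)\<close>, and
    \<open>U \<le> 2 * s l h\<close> makes this at least
    \<open>\<kappa> * s l h powr (1 - p)\<close>.\<close>
  define \<kappa> where "\<kappa> = (p - 1) * 2 powr (- p) / A"
  have \<kappa>: "\<kappa> > 0" using p A by (simp add: \<kappa>_def)
  \<comment> \<open>The induction carries all slopes at once: a node picks the best slope for its
    subtrees, yet must pass on a bound for whatever slope its parent picks. With \<open>m\<close>
    the tree sum of \<open>s\<close> over \<open>A\<close>, the minimum of the right side over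
    \<open>c\<close> is \<open>X - F^p / (s + m)^(p-1)\<close>.\<close>
  have claim: "\<kappa> * tree_sum g n l h \<le> \<Psi> c l h + (p - 1) * c powr p * (tree_sum s n l h / A)"
    if "0 \<le> c" "0 < h" for c n l h
    using that
  proof (induction n arbitrary: c l h)
    case 0
    then show ?case using \<Psi>_nonneg by simp
  next
    case (Suc n)
    define S where "S = \<kappa> * (tree_sum g n l (h / 2) + tree_sum g n (l + h / 2) (h / 2))"
    define m where "m = (tree_sum s n l (h / 2) + tree_sum s n (l + h / 2) (h / 2)) / A"
    have "0 < h / 2" using Suc.prems by simp
    have m0: "0 \<le> m" using A Suc.prems s unfolding m_def
      by (intro divide_nonneg_pos add_nonneg_nonneg tree_sum_nonneg) auto
    \<comment> \<open>Both subtrees use the same slope, so that their planes can be merged by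
      \<open>\<Psi>_super\<close>.\<close>
    have S_le: "S \<le> \<Psi> c' l h + (p - 1) * c' powr p * m" if "0 \<le> c'" for c'
    proof -
      have "S \<le> (\<Psi> c' l (h/2) + (p - 1) * c' powr p * (tree_sum s n l (h/2) / A))
              + (\<Psi> c' (l+h/2) (h/2) + (p - 1) * c' powr p * (tree_sum s n (l+h/2) (h/2) / A))"
        unfolding S_def distrib_left
        by (intro add_mono Suc.IH) (use that \<open>0 < h / 2\<close> in auto)
      also have "\<dots> \<le> \<Psi> c' l h + (p - 1) * c' powr p * m"
        using \<Psi>_super[OF that Suc.prems(2), of l] by (simp add: m_def algebra_simps add_divide_distrib)
      finally show ?thesis .
    qed
    have goal_eq: "\<kappa> * tree_sum g (Suc n) l h = S + \<kappa> * g l h"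
      "tree_sum s (Suc n) l h / A = m + s l h / A"
      by (simp_all add: S_def m_def algebra_simps add_divide_distrib)
    show ?case
    proof (cases "s l h = 0")
      case True
      then have "g l h = 0" using F0 Suc.prems p by (simp add: g_def)
      then show ?thesis
        unfolding goal_eq using S_le[of c] Suc.prems True by simp
    next
      case False
      then have sp: "s l h > 0" using s Suc.prems by (simp add: less_le)
      \<comment> \<open>Denominators of the Bellman function: \<open>V\<close> counts only the
        proper descendants in the tree sum, \<open>U\<close> counts the node as well.\<close>
      define V where "V = s l h + m"
      define U where "U = V + s l h / A"
      have UV: "0 < V" "V \<le> U" "U > 0" using sp m0 A by (auto simp: U_def V_def add_pos_pos add_pos_nonneg)
      \<comment> \<open>The only use of the Carleson bound: node and descendants form a tree of
        depth \<open>Suc n\<close>.\<close>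
      have U2: "U \<le> 2 * s l h"
      proof -
        have "m + s l h / A \<le> s l h"
          using Carleson[OF Suc.prems(2), of "Suc n" l] A unfolding goal_eq(2)[symmetric]
          by (simp add: field_simps)
        then show ?thesis by (simp add: U_def V_def)
      qed
      define f where "f = F l h"
      have f0: "0 \<le> f" using F Suc.prems by (simp add: f_def)
      \<comment> \<open>\<open>f / V\<close> is the slope that minimises the plane at mass
        \<open>V\<close>, and the minimum is minus the Bellman value.\<close>
      have eqV: "(p - 1) * (f / V) powr p * V - p * (f / V) powr (p - 1) * f = - (f powr p * V powr (1 - p))"
      proof (cases "f = 0")
        case True then show ?thesis using p by simp
      next
        case False
        then have fp: "f > 0" using f0 by simp
        have 1: "(f / V) powr p * V = f powr p * V powr (1 - p)"
          using fp UV by (simp add: powr_divide powr_diff)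
        have 2: "(f / V) powr (p - 1) * f = f powr p * V powr (1 - p)"
          using fp UV by (simp add: powr_divide powr_diff)
        show ?thesis using 1 2 by (simp add: algebra_simps)
      qed
      have S1: "S + f powr p * V powr (1 - p) \<le> X l h"
        using S_le[of "f / V"] f0 UV eqV by (simp add: \<Psi>_def V_def f_def[symmetric] algebra_simps)
      \<comment> \<open>At mass \<open>U\<close> the plane of any slope \<open>c\<close> lies above
        its minimum: \<open>Young_powr\<close> at the point \<open>f / U\<close>, scaled by
        \<open>U\<close>.\<close>
      have S2: "p * c powr (p - 1) * f \<le> f powr p * U powr (1 - p) + (p - 1) * c powr p * U"
      proof -
        have "p * (c) powr (p - 1) * (f / U) \<le> (f / U) powr p + (p - 1) * c powr p"
          using p f0 UV Suc.prems by (intro Young_powr) auto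
        then have "U * (p * (c) powr (p - 1) * (f / U)) \<le> U * ((f / U) powr p + (p - 1) * c powr p)"
          using UV by (intro mult_left_mono) auto
        also have "U * (f / U) powr p = f powr p * U powr (1 - p)"
          using f0 UV by (simp add: powr_divide powr_diff)
        then have "U * ((f / U) powr p + (p - 1) * c powr p) = f powr p * U powr (1 - p) + (p - 1) * c powr p * U"
          by (simp add: algebra_simps)
        finally show ?thesis using UV by simp
      qed
      have S3: "f powr p * U powr (1 - p) + \<kappa> * g l h \<le> f powr p * V powr (1 - p)"
      proof -
        have "\<kappa> * s l h powr (1 - p) = (p - 1) * (2 * s l h) powr (-p) * (s l h / A)"
          using sp A by (simp add: \<kappa>_def powr_mult powr_diff powr_minus divide_simps)
        also have "\<dots> \<le> (p - 1) * U powr (-p) * (s l h / A)"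
          using U2 UV sp A p by (intro mult_right_mono mult_left_mono powr_mono2') auto
        finally have "U powr (1 - p) + \<kappa> * s l h powr (1 - p) \<le> V powr (1 - p)"
          using powr_tangent[OF p UV(1,2)] by (simp add: U_def)
        then have "f powr p * (U powr (1 - p) + \<kappa> * s l h powr (1 - p)) \<le> f powr p * V powr (1 - p)"
          by (intro mult_left_mono) auto
        then show ?thesis by (simp add: g_def f_def algebra_simps)
      qed
      show ?thesis
        unfolding goal_eq using S1 S2 S3 by (simp add: \<Psi>_def U_def V_def f_def[symmetric] algebra_simps)
    qed
  qed
  \<comment> \<open>At slope 0 every term but \<open>X l h\<close> vanishes, as
    \<open>0 powr\<close> is 0 for every exponent.\<close>
  have "\<kappa> * tree_sum g n l h \<le> X l h"
    using claim[of 0 h n l] h p by (simp add: \<Psi>_def)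
  then have "tree_sum g n l h \<le> X l h / \<kappa>" using \<kappa> by (simp add: field_simps)
  also have "\<dots> = A * 2 powr p / (p - 1) * X l h" using p A
    by (simp add: \<kappa>_def powr_minus divide_simps)
  finally show ?thesis by (simp add: g_def)
qed

section \<open>Carleson boxes\<close>

text \<open>Half-open in the real direction, unlike \<open>Qbox\<close>, so that the two halves of
  an interval give disjoint boxes; the missing edge is null for \<open>Valpha\<close>.\<close>

definition hbox :: "real \<Rightarrow> real \<Rightarrow> complex set" where
  "hbox l h = {z. l \<le> Re z \<and> Re z < l + h \<and> 0 < Im z \<and> Im z < h}"

text \<open>The edge at height \<open>h / 2\<close> belongs to the top half because the child boxes
  omit it.\<close>

definition tbox :: "real \<Rightarrow> real \<Rightarrow> complex set" where
  "tbox l h = {z. l \<le> Re z \<and> Re z < l + h \<and> h / 2 \<le> Im z \<and> Im z < h}"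

lemma UHP_borel [measurable]: "UHP \<in> sets borel"
  unfolding UHP_def by measurable

lemma Qbox_borel [measurable]: "Qbox a b \<in> sets borel"
  unfolding Qbox_def by measurable

lemma hbox_borel [measurable]: "hbox l h \<in> sets borel"
  unfolding hbox_def by measurable

lemma tbox_borel [measurable]: "tbox l h \<in> sets borel"
  unfolding tbox_def by measurable

lemma sets_Valpha [measurable_cong, simp]: "sets (Valpha \<alpha>) = sets borel"
  by (simp add: Valpha_def)

lemma space_Valpha [simp]: "space (Valpha \<alpha>) = UNIV"
  by (simp add: Valpha_def)

lemma AE_Valpha_UHP: "AE z in Valpha \<alpha>. z \<in> UHP"
  unfolding Valpha_def by (subst AE_density) (auto simp: indicator_def)

lemma nn_integral_Valpha:
  assumes [measurable]: "g \<in> borel_measurable borel"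
  shows "(\<integral>\<^sup>+ z. g z \<partial>Valpha \<alpha>) = (\<integral>\<^sup>+ z. indicator UHP z * ennreal (Im z powr \<alpha>) * g z \<partial>lborel)"
  unfolding Valpha_def by (subst nn_integral_density) auto

text \<open>The logarithm of \<open>y / h\<close> lies between \<open>- ln 2\<close> and 0;
  \<open>\<bar>\<alpha>\<bar>\<close> lets one constant serve both signs of the exponent.\<close>

lemma powr_near:
  fixes y h \<alpha> :: real
  assumes "0 < h" "h / 2 \<le> y" "y \<le> h"
  shows "2 powr (- \<bar>\<alpha>\<bar>) * h powr \<alpha> \<le> y powr \<alpha>" "y powr \<alpha> \<le> 2 powr \<bar>\<alpha>\<bar> * h powr \<alpha>"
proof -
  have y: "0 < y" using assms by linarith
  have "\<bar>\<alpha> * ln (y / h)\<bar> \<le> \<bar>\<alpha>\<bar> * ln 2"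
  proof -
    have "ln (1/2) \<le> ln (y / h)" "ln (y / h) \<le> ln 1"
      using assms y by (auto simp del: ln_one intro!: ln_mono simp: field_simps)
    then have "\<bar>ln (y / h)\<bar> \<le> ln 2" by (simp add: ln_div)
    then show ?thesis by (simp add: abs_mult mult_left_mono)
  qed
  then have "- (\<bar>\<alpha>\<bar> * ln 2) + \<alpha> * ln h \<le> \<alpha> * ln y" "\<alpha> * ln y \<le> \<bar>\<alpha>\<bar> * ln 2 + \<alpha> * ln h"
    using assms y by (auto simp: ln_div algebra_simps abs_le_iff)
  then show "2 powr (- \<bar>\<alpha>\<bar>) * h powr \<alpha> \<le> y powr \<alpha>" "y powr \<alpha> \<le> 2 powr \<bar>\<alpha>\<bar> * h powr \<alpha>"
    using assms y by (auto simp: powr_def exp_add[symmetric])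
qed

lemma emeasure_tbox_ge:
  assumes "0 < h"
  shows "ennreal (2 powr (- \<bar>\<alpha>\<bar>) / 2 * h powr (2 + \<alpha>)) \<le> emeasure (Valpha \<alpha>) (tbox l h)"
proof -
  let ?B = "box (Complex l (h / 2)) (Complex (l + h) h)"
  have sub: "?B \<subseteq> tbox l h"
    using assms by (auto simp: box_def Basis_complex_def tbox_def)
  have em: "emeasure lborel ?B = ennreal (h * (h / 2))"
    using assms by (subst emeasure_lborel_box) (auto simp: Basis_complex_def)
  have "ennreal (2 powr (- \<bar>\<alpha>\<bar>) / 2 * h powr (2 + \<alpha>))
      = ennreal (2 powr (- \<bar>\<alpha>\<bar>) * h powr \<alpha>) * ennreal (h * (h / 2))"
    using assms by (simp add: ennreal_mult[symmetric] powr_add power2_eq_square)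
  also have "\<dots> = (\<integral>\<^sup>+ z. ennreal (2 powr (- \<bar>\<alpha>\<bar>) * h powr \<alpha>) * indicator ?B z \<partial>lborel)"
    by (simp add: nn_integral_cmult_indicator em)
  also have "\<dots> \<le> (\<integral>\<^sup>+ z. indicator UHP z * ennreal (Im z powr \<alpha>) * indicator (tbox l h) z \<partial>lborel)"
  proof (rule nn_integral_mono)
    fix z
    show "ennreal (2 powr (- \<bar>\<alpha>\<bar>) * h powr \<alpha>) * indicator ?B z
       \<le> indicator UHP z * ennreal (Im z powr \<alpha>) * indicator (tbox l h) z"
      using sub powr_near(1)[of h "Im z" \<alpha>] assms
      by (auto simp: indicator_def UHP_def tbox_def intro!: ennreal_leI)
  qed
  also have "\<dots> = (\<integral>\<^sup>+ z. indicator (tbox l h) z \<partial>Valpha \<alpha>)"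
    by (subst nn_integral_Valpha) auto
  also have "\<dots> = emeasure (Valpha \<alpha>) (tbox l h)"
    by simp
  finally show ?thesis .
qed

text \<open>The density may blow up at the real axis, so the box is cut into layers of halving
  height. Layer \<open>k\<close> contributes at most a multiple of \<open>r ^ k\<close>, and
  \<open>\<alpha> > -1\<close> is what makes \<open>r < 1\<close>.\<close>

lemma emeasure_Qbox_le:
  assumes "-1 < \<alpha>"
  shows "\<exists>K>0. \<forall>a b. a < b \<longrightarrow> emeasure (Valpha \<alpha>) (Qbox a b) \<le> ennreal (K * (b - a) powr (2 + \<alpha>))"
proof -
  define r where "r = (2::real) powr (- (1 + \<alpha>))"
  have r: "0 < r" "r < 1" using assms by (auto simp: r_def powr_less_one)
  define K where "K = 2 powr \<bar>\<alpha>\<bar> / 2 * (1 / (1 - r))"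
  have "emeasure (Valpha \<alpha>) (Qbox a b) \<le> ennreal (K * (b - a) powr (2 + \<alpha>))" if "a < b" for a b
  proof -
    define h where "h = b - a"
    have h: "0 < h" using that by (simp add: h_def)
    define y where "y k = h / 2 ^ k" for k
    have y: "0 < y k" for k using h by (simp add: y_def)
    \<comment> \<open>Closed layers share edges, which an upper bound tolerates, and each is a box
      of known Lebesgue measure.\<close>
    define S where "S k = {z. a \<le> Re z \<and> Re z \<le> b \<and> y k / 2 \<le> Im z \<and> Im z \<le> y k}" for k
    have [measurable]: "S k \<in> sets borel" for k unfolding S_def by measurable
    have S_eq: "S k = cbox (Complex a (y k / 2)) (Complex b (y k))" for k
      by (auto simp: S_def cbox_def Basis_complex_def)
    have emS: "emeasure lborel (S k) = ennreal (h * (y k / 2))" for k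
      unfolding S_eq using that y[of k]
      by (subst emeasure_lborel_cbox) (auto simp: Basis_complex_def h_def)
    have cover: "Qbox a b \<subseteq> (\<Union>k. S k)"
    proof
      fix z assume z: "z \<in> Qbox a b"
      then have I: "0 < Im z" "Im z < h" by (auto simp: Qbox_def h_def)
      obtain n where n: "(1/2)^n < Im z / h"
        using real_arch_pow_inv[of "Im z / h" "1/2"] I h by auto
      \<comment> \<open>The first level whose successor lies strictly below \<open>z\<close>; by
        minimality \<open>z\<close> is not above level \<open>k\<close> itself.\<close>
      define k where "k = (LEAST n. y (Suc n) < Im z)"
      have ex: "y (Suc n) < Im z"
      proof -
        have "y (Suc n) \<le> y n" using y[of n] by (simp add: y_def)
        also have "\<dots> < Im z" using n h by (simp add: y_def field_simps power_one_over)
        finally show ?thesis .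
      qed
      have 1: "y (Suc k) < Im z" unfolding k_def by (rule LeastI[of "\<lambda>n. y (Suc n) < Im z", OF ex])
      have 2: "Im z \<le> y k"
      proof (cases k)
        case 0 then show ?thesis using I by (simp add: y_def)
      next
        case (Suc j)
        then have "\<not> y (Suc j) < Im z" using not_less_Least[of j "\<lambda>n. y (Suc n) < Im z"] by (simp add: k_def)
        then show ?thesis using Suc by simp
      qed
      have "z \<in> S k" using 1 2 z by (auto simp: S_def Qbox_def y_def)
      then show "z \<in> (\<Union>k. S k)" by blast
    qed
    have emV: "emeasure (Valpha \<alpha>) (S k) \<le> ennreal (2 powr \<bar>\<alpha>\<bar> / 2 * h powr (2 + \<alpha>) * r ^ k)" for k
    proof -
      have "emeasure (Valpha \<alpha>) (S k) = (\<integral>\<^sup>+ z. indicator (S k) z \<partial>Valpha \<alpha>)" by simp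
      also have "\<dots> = (\<integral>\<^sup>+ z. indicator UHP z * ennreal (Im z powr \<alpha>) * indicator (S k) z \<partial>lborel)"
        by (subst nn_integral_Valpha) auto
      also have "\<dots> \<le> (\<integral>\<^sup>+ z. ennreal (2 powr \<bar>\<alpha>\<bar> * y k powr \<alpha>) * indicator (S k) z \<partial>lborel)"
      proof (rule nn_integral_mono)
        fix z show "indicator UHP z * ennreal (Im z powr \<alpha>) * indicator (S k) z
            \<le> ennreal (2 powr \<bar>\<alpha>\<bar> * y k powr \<alpha>) * indicator (S k) z"
          using powr_near(2)[of "y k" "Im z" \<alpha>] y[of k]
          by (auto simp: indicator_def S_def intro!: ennreal_leI)
      qed
      also have "\<dots> = ennreal (2 powr \<bar>\<alpha>\<bar> * y k powr \<alpha>) * ennreal (h * (y k / 2))"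
        by (simp add: nn_integral_cmult_indicator emS)
      also have "\<dots> = ennreal (2 powr \<bar>\<alpha>\<bar> / 2 * h powr (2 + \<alpha>) * r ^ k)"
      proof -
        have "y k powr \<alpha> * y k = y k powr (1 + \<alpha>)" using y[of k] by (simp add: powr_add)
        also have "\<dots> = h powr (1 + \<alpha>) * r ^ k"
        proof -
          have "r ^ k = (2 ^ k) powr (- (1 + \<alpha>))"
            unfolding r_def by (simp add: powr_realpow[symmetric] powr_powr mult_ac)
          moreover have "inverse ((2 ^ k) powr (1 + \<alpha>)) = (2 ^ k) powr (- (1 + \<alpha>))"
            by (rule powr_minus[symmetric])
          ultimately show ?thesis using h unfolding y_def
            by (subst powr_divide) (auto simp: divide_inverse)
        qed
        finally have 1: "y k powr \<alpha> * y k = h powr (1 + \<alpha>) * r ^ k" .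
        have 2: "h powr (2 + \<alpha>) = h * h powr (1 + \<alpha>)" using h by (simp add: powr_mult_base)
        have "2 powr \<bar>\<alpha>\<bar> * y k powr \<alpha> * (h * (y k / 2)) = 2 powr \<bar>\<alpha>\<bar> / 2 * h * (y k powr \<alpha> * y k)"
          by simp
        then have "2 powr \<bar>\<alpha>\<bar> * y k powr \<alpha> * (h * (y k / 2)) = 2 powr \<bar>\<alpha>\<bar> / 2 * h powr (2 + \<alpha>) * r ^ k"
          by (simp add: 1 2)
        moreover have "ennreal (2 powr \<bar>\<alpha>\<bar> * y k powr \<alpha>) * ennreal (h * (y k / 2))
            = ennreal (2 powr \<bar>\<alpha>\<bar> * y k powr \<alpha> * (h * (y k / 2)))"
          using h y[of k] by (intro ennreal_mult[symmetric]) auto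
        ultimately show ?thesis by (simp only:)
      qed
      finally show ?thesis .
    qed
    have "emeasure (Valpha \<alpha>) (Qbox a b) \<le> emeasure (Valpha \<alpha>) (\<Union>k. S k)"
      by (rule emeasure_mono[OF cover]) auto
    also have "\<dots> \<le> (\<Sum>k. emeasure (Valpha \<alpha>) (S k))"
      by (rule emeasure_subadditive_countably) auto
    also have "\<dots> \<le> (\<Sum>k. ennreal (2 powr \<bar>\<alpha>\<bar> / 2 * h powr (2 + \<alpha>) * r ^ k))"
      by (intro suminf_le emV) auto
    also have "\<dots> = ennreal (\<Sum>k. 2 powr \<bar>\<alpha>\<bar> / 2 * h powr (2 + \<alpha>) * r ^ k)"
      using r by (intro suminf_ennreal2 summable_mult summable_geometric) auto
    also have "(\<Sum>k. 2 powr \<bar>\<alpha>\<bar> / 2 * h powr (2 + \<alpha>) * r ^ k) = K * h powr (2 + \<alpha>)"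
      using r by (subst suminf_mult) (auto simp: K_def suminf_geometric summable_geometric)
    finally show ?thesis by (simp add: h_def)
  qed
  moreover have "K > 0" using r by (simp add: K_def)
  ultimately show ?thesis by blast
qed

lemma emeasure_Valpha_vline: "emeasure (Valpha \<alpha>) {z. Re z = b} = 0"
proof -
  have "negligible {z::complex. z \<bullet> 1 = b}"
    by (rule negligible_standard_hyperplane) (simp add: Basis_complex_def)
  then have "{z. Re z = b} \<in> null_sets lebesgue"
    by (simp add: negligible_iff_null_sets)
  moreover have [measurable]: "{z. Re z = b} \<in> sets borel" by measurable
  ultimately have "{z. Re z = b} \<in> null_sets lborel"
    by (auto simp: null_sets_def)
  then have "AE z in lborel. z \<notin> {z. Re z = b}" by (rule AE_not_in)
  then have "AE z in Valpha \<alpha>. z \<notin> {z. Re z = b}"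
    unfolding Valpha_def by (subst AE_density) auto
  then show ?thesis by (subst (asm) AE_iff_null_sets[symmetric]) auto
qed

section \<open>The weight condition as a Carleson condition\<close>

definition weighted :: "(complex \<Rightarrow> real) \<Rightarrow> real \<Rightarrow> complex measure" where
  "weighted \<sigma> \<alpha> = density (Valpha \<alpha>) (\<lambda>z. ennreal (\<sigma> z))"

lemma sets_weighted [measurable_cong, simp]: "sets (weighted \<sigma> \<alpha>) = sets borel"
  by (simp add: weighted_def)

lemma space_weighted [simp]: "space (weighted \<sigma> \<alpha>) = UNIV"
  by (simp add: weighted_def)

lemma weight_measurable: "is_weight \<sigma> \<Longrightarrow> \<sigma> \<in> borel_measurable borel"
  by (simp add: is_weight_def)

lemma nn_integral_weighted:
  assumes "is_weight \<sigma>" "g \<in> borel_measurable borel"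
  shows "(\<integral>\<^sup>+ z. g z \<partial>weighted \<sigma> \<alpha>) = (\<integral>\<^sup>+ z. ennreal (\<sigma> z) * g z \<partial>Valpha \<alpha>)"
  using weight_measurable[OF assms(1)] assms(2)
  unfolding weighted_def by (subst nn_integral_density) auto

lemma wmeas_eq:
  assumes "is_weight \<sigma>" "E \<in> sets borel"
  shows "wmeas \<sigma> \<alpha> E = emeasure (weighted \<sigma> \<alpha>) E"
proof -
  have "emeasure (weighted \<sigma> \<alpha>) E = (\<integral>\<^sup>+ z. indicator E z \<partial>weighted \<sigma> \<alpha>)"
    using assms by simp
  also have "\<dots> = wmeas \<sigma> \<alpha> E"
    unfolding wmeas_def using assms by (subst nn_integral_weighted) auto
  finally show ?thesis by simp
qed

lemma nn_integral_wmul: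
  assumes w: "is_weight \<sigma>" and [measurable]: "f \<in> borel_measurable borel" "E \<in> sets borel"
  shows "(\<integral>\<^sup>+ z. ennreal (norm (wmul \<sigma> f z)) * indicator E z \<partial>Valpha \<alpha>)
       = (\<integral>\<^sup>+ z. ennreal (norm (f z)) * indicator E z \<partial>weighted \<sigma> \<alpha>)"
proof -
  \<comment> \<open>\<open>is_weight\<close> fixes the sign of \<sigma> only on \<open>UHP\<close>,
    the set that carries \<open>Valpha\<close>.\<close>
  have "AE z in Valpha \<alpha>. 0 \<le> \<sigma> z"
    using AE_Valpha_UHP[of \<alpha>] w by (auto simp: is_weight_def)
  then show ?thesis
    by (subst nn_integral_weighted[OF w], simp, intro nn_integral_cong_AE, elim eventually_mono)
       (auto simp: wmul_def norm_mult ennreal_mult mult_ac)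
qed

lemma nn_integral_powr_weighted:
  assumes w: "is_weight \<sigma>" and [measurable]: "f \<in> borel_measurable borel"
  shows "(\<integral>\<^sup>+ z. ennreal (norm (f z) powr p * \<sigma> z) \<partial>Valpha \<alpha>)
       = (\<integral>\<^sup>+ z. ennreal (norm (f z) powr p) \<partial>weighted \<sigma> \<alpha>)"
  by (subst nn_integral_weighted[OF w]) (auto simp: ennreal_mult' mult.commute[of "ennreal (\<sigma> _)"])

lemma emeasure_hbox_eq_Qbox:
  assumes "is_weight \<sigma>"
  shows "emeasure (weighted \<sigma> \<alpha>) (hbox l h) = emeasure (weighted \<sigma> \<alpha>) (Qbox l (l + h))"
proof (rule emeasure_eq_AE)
  have "AE z in Valpha \<alpha>. z \<notin> {z. Re z = l + h}"
    by (intro AE_not_in) (auto simp: null_sets_def emeasure_Valpha_vline)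
  then have "AE z in weighted \<sigma> \<alpha>. z \<notin> {z. Re z = l + h}"
    unfolding weighted_def using weight_measurable[OF assms] by (subst AE_density) auto
  then show "AE z in weighted \<sigma> \<alpha>. (z \<in> hbox l h) = (z \<in> Qbox l (l + h))"
    by eventually_elim (auto simp: hbox_def Qbox_def)
qed auto

text \<open>Rests on the convention in \<open>Binf_const\<close> that a box of infinite mass has an
  infinite quotient.\<close>

lemma emeasure_Qbox_finite:
  assumes w: "is_weight \<sigma>" and "in_Binf \<sigma> \<alpha>" "a < b"
  shows "emeasure (weighted \<sigma> \<alpha>) (Qbox a b) < \<infinity>"
proof (rule ccontr)
  assume "\<not> ?thesis"
  then have "wmeas \<sigma> \<alpha> (Qbox a b) = \<infinity>" by (simp add: wmeas_eq[OF w] less_top[symmetric])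
  then have "\<infinity> \<le> Binf_const \<sigma> \<alpha>" unfolding Binf_const_def
    using assms(3) by (intro SUP_upper2[of "(a, b)"]) auto
  then show False using assms(2) by (simp add: in_Binf_def top_unique)
qed

lemma emeasure_hbox_finite:
  assumes "is_weight \<sigma>" "in_Binf \<sigma> \<alpha>" "0 < h"
  shows "emeasure (weighted \<sigma> \<alpha>) (hbox l h) < \<infinity>"
  using assms emeasure_Qbox_finite[of \<sigma> \<alpha> l "l + h"] by (simp add: emeasure_hbox_eq_Qbox)

lemma Binf_Qbox:
  assumes w: "is_weight \<sigma>" and B: "in_Binf \<sigma> \<alpha>" and ab: "a < b"
  shows "(\<integral>\<^sup>+ z. Mfrac \<alpha> 0 (\<lambda>w. complex_of_real (\<sigma> w * indicator (Qbox a b) w)) z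
            * indicator (Qbox a b) z \<partial>Valpha \<alpha>)
         \<le> Binf_const \<sigma> \<alpha> * emeasure (weighted \<sigma> \<alpha>) (Qbox a b)" (is "?I \<le> _")
proof -
  let ?e = "emeasure (weighted \<sigma> \<alpha>) (Qbox a b)"
  have fin: "?e < \<infinity>" by (rule emeasure_Qbox_finite[OF assms])
  have "?I / ?e \<le> Binf_const \<sigma> \<alpha>"
    unfolding Binf_const_def using ab fin
    by (intro SUP_upper2[of "(a, b)"]) (auto simp: wmeas_eq[OF w])
  moreover have "Binf_const \<sigma> \<alpha> < \<infinity>" using B by (simp add: in_Binf_def)
  ultimately have le: "?I / ?e \<le> Binf_const \<sigma> \<alpha>" and ne: "?I / ?e \<noteq> \<infinity>" by auto
  show ?thesis
  proof (cases "?e = 0")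
    \<comment> \<open>Division by 0 gives infinity unless the numerator is 0, so a finite quotient
      forces \<open>?I = 0\<close>.\<close>
    case True
    then have "?I = 0" using ne by (auto simp: divide_ennreal_def ennreal_mult_eq_top_iff)
    then show ?thesis by simp
  next
    case False
    then have "?I = ?I / ?e * ?e"
      using fin unfolding ennreal_divide_times by (subst ennreal_divide_self) auto
    also have "\<dots> \<le> Binf_const \<sigma> \<alpha> * ?e" by (intro mult_right_mono le) auto
    finally show ?thesis .
  qed
qed

lemma hbox_split:
  assumes "0 < h"
  shows "tbox l h \<inter> hbox l (h / 2) = {}" "tbox l h \<inter> hbox (l + h / 2) (h / 2) = {}"
    "hbox l (h / 2) \<inter> hbox (l + h / 2) (h / 2) = {}"
    "tbox l h \<subseteq> hbox l h" "hbox l (h / 2) \<subseteq> hbox l h" "hbox (l + h / 2) (h / 2) \<subseteq> hbox l h"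
  using assms by (auto simp: hbox_def tbox_def)

text \<open>At each \<open>z\<close> at most one term of the sum survives. The indicator of the root
  box on the right is what allows the top and the two children, being disjoint, to be added up in
  the induction.\<close>

lemma tree_sum_tops_le:
  fixes H :: "complex \<Rightarrow> ennreal"
  assumes "\<And>l h z. 0 < h \<Longrightarrow> hbox l h \<subseteq> R \<Longrightarrow> z \<in> tbox l h \<Longrightarrow> c l h \<le> H z"
    and "0 < h" "hbox l h \<subseteq> R"
  shows "tree_sum (\<lambda>l h. c l h * indicator (tbox l h) z) n l h \<le> H z * indicator (hbox l h) z"
  using assms(2,3)
proof (induction n arbitrary: l h)
  case (Suc n)
  note sp = hbox_split[OF Suc.prems(1), of l]
  have "0 < h / 2" using Suc.prems by simp
  have 1: "tree_sum (\<lambda>l h. c l h * indicator (tbox l h) z) n l (h/2) \<le> H z * indicator (hbox l (h/2)) z"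
    using Suc.prems sp by (intro Suc.IH) auto
  have 2: "tree_sum (\<lambda>l h. c l h * indicator (tbox l h) z) n (l+h/2) (h/2) \<le> H z * indicator (hbox (l+h/2) (h/2)) z"
    using Suc.prems sp by (intro Suc.IH) auto
  have 3: "c l h * indicator (tbox l h) z \<le> H z * indicator (tbox l h) z"
    using assms(1)[OF Suc.prems] by (auto simp: indicator_def)
  have "tree_sum (\<lambda>l h. c l h * indicator (tbox l h) z) (Suc n) l h
     \<le> H z * indicator (tbox l h) z + H z * indicator (hbox l (h/2)) z + H z * indicator (hbox (l+h/2) (h/2)) z"
    unfolding tree_sum.simps by (intro add_mono 1 2 3)
  also have "\<dots> \<le> H z * indicator (hbox l h) z"
    using sp by (auto simp: indicator_def)
  finally show ?case .
qed simp

text \<open>The top halves of the boxes in one dyadic tree are disjoint and each carries a fixed fraction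
  of the volume of its box, so the average of \<open>\<sigma>\<close> over a box may be integrated over its top half,
  where it is dominated by the maximal function in the definition of \<open>B\<^sub>\<infinity>\<close>.\<close>

lemma Carleson_weight:
  assumes w: "is_weight \<sigma>" and B: "in_Binf \<sigma> \<alpha>" and h: "0 < h"
  shows "tree_sum (\<lambda>l h. measure (weighted \<sigma> \<alpha>) (hbox l h)) n l h
    \<le> 2 * 2 powr \<bar>\<alpha>\<bar> * enn2real (Binf_const \<sigma> \<alpha>) * measure (weighted \<sigma> \<alpha>) (hbox l h)"
proof -
  let ?\<nu> = "weighted \<sigma> \<alpha>"
  have [measurable]: "\<sigma> \<in> borel_measurable borel" using w by (rule weight_measurable)
  \<comment> \<open>One maximal function serves the whole tree: \<sigma> is cut off to the root box,
    and every box of the tree lies inside it and keeps its mass.\<close>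
  define R where "R = Qbox l (l + h)"
  have [measurable]: "R \<in> sets borel" by (simp add: R_def)
  define H where "H = Mfrac \<alpha> 0 (\<lambda>w. complex_of_real (\<sigma> w * indicator R w))"
  \<comment> \<open>Reciprocal of the constant in \<open>emeasure_tbox_ge\<close>.\<close>
  define C where "C = 2 * 2 powr \<bar>\<alpha>\<bar>"
  define c where "c l h = ennreal (h powr - (2 + \<alpha>)) * emeasure ?\<nu> (hbox l h)" for l h
  have fin: "emeasure ?\<nu> (hbox l h) = ennreal (measure ?\<nu> (hbox l h))" if "0 < h" for l h
    using emeasure_hbox_finite[OF w B that, of l] by (intro emeasure_eq_ennreal_measure) auto
  \<comment> \<open>The average over a box is one of the competitors in the supremum at each point
    of its top half.\<close>
  have cH: "c l h \<le> H z" if "0 < h" "hbox l h \<subseteq> R" "z \<in> tbox l h" for l h z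
  proof -
    have "z \<in> Qbox l (l + h)" using that by (auto simp: Qbox_def tbox_def)
    have "emeasure ?\<nu> (hbox l h) = (\<integral>\<^sup>+ u. ennreal (\<sigma> u) * indicator (hbox l h) u \<partial>Valpha \<alpha>)"
      using w by (subst wmeas_eq[symmetric]) (auto simp: wmeas_def)
    also have "\<dots> \<le> (\<integral>\<^sup>+ u. ennreal (norm (complex_of_real (\<sigma> u * indicator R u)))
              * indicator (Qbox l (l + h)) u \<partial>Valpha \<alpha>)"
      using that by (intro nn_integral_mono)
        (auto simp: indicator_def hbox_def Qbox_def intro!: ennreal_leI)
    finally show ?thesis
      unfolding H_def Mfrac_def c_def using that \<open>z \<in> Qbox l (l + h)\<close>
      by (intro SUP_upper2[of "(l, l + h)"]) (auto intro!: mult_left_mono)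
  qed
  have sc: "ennreal (measure ?\<nu> (hbox l h)) \<le> ennreal C * (\<integral>\<^sup>+ z. c l h * indicator (tbox l h) z \<partial>Valpha \<alpha>)"
    if "0 < h" for l h
  proof -
    have "ennreal C * (ennreal (h powr - (2 + \<alpha>)) * ennreal (2 powr (- \<bar>\<alpha>\<bar>) / 2 * h powr (2 + \<alpha>))) = 1"
    proof -
      have "h powr - (2 + \<alpha>) * h powr (2 + \<alpha>) = 1"
        using that unfolding powr_add[symmetric] by simp
      moreover have "(2::real) powr - \<bar>\<alpha>\<bar> * 2 powr \<bar>\<alpha>\<bar> = 1"
        unfolding powr_add[symmetric] by simp
      ultimately have "C * (h powr - (2 + \<alpha>) * (2 powr (- \<bar>\<alpha>\<bar>) / 2 * h powr (2 + \<alpha>))) = 1"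
        unfolding C_def by algebra
      then show ?thesis by (simp add: C_def ennreal_mult[symmetric])
    qed
    then have "ennreal (measure ?\<nu> (hbox l h)) = ennreal C * (c l h * ennreal (2 powr (- \<bar>\<alpha>\<bar>) / 2 * h powr (2 + \<alpha>)))"
      unfolding c_def fin[OF that] by (metis (no_types, lifting) mult.commute mult.left_commute mult_1)
    also have "\<dots> \<le> ennreal C * (c l h * emeasure (Valpha \<alpha>) (tbox l h))"
      by (intro mult_left_mono emeasure_tbox_ge that) auto
    finally show ?thesis by (simp add: nn_integral_cmult_indicator)
  qed
  have hR: "hbox l h \<subseteq> R" by (auto simp: R_def hbox_def Qbox_def)
  have "ennreal (tree_sum (\<lambda>l h. measure ?\<nu> (hbox l h)) n l h)
      = tree_sum (\<lambda>l h. ennreal (measure ?\<nu> (hbox l h))) n l h"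
    by (rule ennreal_tree_sum) (use h in auto)
  also have "\<dots> \<le> tree_sum (\<lambda>l h. ennreal C * (\<integral>\<^sup>+ z. c l h * indicator (tbox l h) z \<partial>Valpha \<alpha>)) n l h"
    by (rule tree_sum_mono) (use h sc in auto)
  also have "\<dots> = ennreal C * (\<integral>\<^sup>+ z. tree_sum (\<lambda>l h. c l h * indicator (tbox l h) z) n l h \<partial>Valpha \<alpha>)"
    by (subst nn_integral_tree_sum) (auto simp: tree_sum_mult_left)
  also have "\<dots> \<le> ennreal C * (\<integral>\<^sup>+ z. H z * indicator R z \<partial>Valpha \<alpha>)"
  proof (intro mult_left_mono nn_integral_mono)
    fix z
    have "tree_sum (\<lambda>l h. c l h * indicator (tbox l h) z) n l h \<le> H z * indicator (hbox l h) z"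
      using cH h hR by (intro tree_sum_tops_le) auto
    also have "\<dots> \<le> H z * indicator R z"
      using hR by (auto simp: indicator_def)
    finally show "tree_sum (\<lambda>l h. c l h * indicator (tbox l h) z) n l h \<le> H z * indicator R z" .
  qed auto
  also have "\<dots> \<le> ennreal C * (Binf_const \<sigma> \<alpha> * emeasure ?\<nu> R)"
    unfolding H_def R_def using h by (intro mult_left_mono Binf_Qbox[OF w B]) auto
  also have "emeasure ?\<nu> R = ennreal (measure ?\<nu> (hbox l h))"
    unfolding R_def emeasure_hbox_eq_Qbox[OF w, symmetric] by (rule fin[OF h])
  also have "Binf_const \<sigma> \<alpha> = ennreal (enn2real (Binf_const \<sigma> \<alpha>))"
    using B by (simp add: in_Binf_def)
  also have "ennreal C * (ennreal (enn2real (Binf_const \<sigma> \<alpha>)) * ennreal (measure ?\<nu> (hbox l h)))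
      = ennreal (C * enn2real (Binf_const \<sigma> \<alpha>) * measure ?\<nu> (hbox l h))"
    by (simp add: C_def ennreal_mult[symmetric] mult.assoc)
  finally show ?thesis
    by (subst (asm) ennreal_le_iff) (auto simp: C_def)
qed

section \<open>The Carleson embedding for functions on the half-plane\<close>

lemma nn_integral_norm_finite:
  assumes w: "is_weight \<sigma>" and B: "in_Binf \<sigma> \<alpha>" and p: "1 < p" and h: "0 < h"
    and [measurable]: "f \<in> borel_measurable borel"
    and fin: "(\<integral>\<^sup>+ z. ennreal (norm (f z) powr p) \<partial>weighted \<sigma> \<alpha>) < \<infinity>"
  shows "(\<integral>\<^sup>+ z. ennreal (norm (f z :: complex)) * indicator (hbox l h) z \<partial>weighted \<sigma> \<alpha>) < \<infinity>"
proof -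
  \<comment> \<open>On a box of finite mass this elementary bound does the work of Hoelder's
    inequality.\<close>
  have le: "x \<le> 1 + x powr p" if "0 \<le> x" for x :: real
  proof (cases "x \<le> 1")
    case False
    then have "x powr 1 \<le> x powr p" using p by (intro powr_mono) auto
    then show ?thesis using False by simp
  qed (simp add: add_increasing2)
  have "(\<integral>\<^sup>+ z. ennreal (norm (f z)) * indicator (hbox l h) z \<partial>weighted \<sigma> \<alpha>)
     \<le> (\<integral>\<^sup>+ z. indicator (hbox l h) z + ennreal (norm (f z) powr p) \<partial>weighted \<sigma> \<alpha>)"
  proof (rule nn_integral_mono)
    fix z
    have "ennreal (norm (f z)) \<le> ennreal (1 + norm (f z) powr p)" by (intro ennreal_leI le) simp
    also have "\<dots> = 1 + ennreal (norm (f z) powr p)" by (subst ennreal_plus) auto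
    finally show "ennreal (norm (f z)) * indicator (hbox l h) z \<le> indicator (hbox l h) z + ennreal (norm (f z) powr p)"
      by (auto simp: indicator_def)
  qed
  also have "\<dots> = emeasure (weighted \<sigma> \<alpha>) (hbox l h) + (\<integral>\<^sup>+ z. ennreal (norm (f z) powr p) \<partial>weighted \<sigma> \<alpha>)"
    by (subst nn_integral_add) auto
  also have "\<dots> < \<infinity>" using fin emeasure_hbox_finite[OF w B h] by simp
  finally show ?thesis .
qed

text \<open>Real-valued because the tangent planes involve subtraction;
  \<open>ennreal_box_int\<close> leads back to extended reals once the integral is known to be
  finite.\<close>

definition box_int :: "complex measure \<Rightarrow> (complex \<Rightarrow> real) \<Rightarrow> real \<Rightarrow> real \<Rightarrow> real" where
  "box_int M g l h = (\<integral> z. indicator (hbox l h) z * g z \<partial>M)"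

lemma ennreal_box_int:
  assumes "sets M = sets borel" "g \<in> borel_measurable borel" "\<And>z. 0 \<le> g z"
    and "(\<integral>\<^sup>+ z. ennreal (g z) * indicator (hbox l h) z \<partial>M) < \<infinity>"
  shows "ennreal (box_int M g l h) = (\<integral>\<^sup>+ z. ennreal (g z) * indicator (hbox l h) z \<partial>M)"
    and "integrable M (\<lambda>z. indicator (hbox l h) z * g z)"
proof -
  note [measurable_cong] = assms(1)
  note [measurable] = assms(2)
  have eq: "ennreal (indicator (hbox l h) z * g z) = ennreal (g z) * indicator (hbox l h) z" for z
    by (auto simp: indicator_def)
  show *: "integrable M (\<lambda>z. indicator (hbox l h) z * g z)"
    using assms(3,4) by (intro integrableI_nonneg) (auto simp: eq)
  show "ennreal (box_int M g l h) = (\<integral>\<^sup>+ z. ennreal (g z) * indicator (hbox l h) z \<partial>M)"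
    unfolding box_int_def using assms(3)
    by (subst nn_integral_eq_integral[symmetric]) (auto simp: * eq)
qed

lemma box_int_null:
  assumes "emeasure M (hbox l h) = 0" "sets M = sets borel"
  shows "box_int M g l h = 0"
proof -
  have "AE z in M. z \<notin> hbox l h"
    using assms by (intro AE_not_in) (auto simp: null_sets_def)
  then have "AE z in M. indicator (hbox l h) z * g z = 0"
    by eventually_elim auto
  then show ?thesis unfolding box_int_def by (rule integral_eq_zero_AE)
qed

text \<open>The planes of \<open>Carleson_embedding\<close> become integrals of one nonnegative
  function over the box. Hence they are nonnegative, and superadditive because the children are
  disjoint parts of the box. \<open>A\<close> is a free upper bound so that it can be kept
  positive.\<close>

lemma weighted_embedding:
  fixes f :: "complex \<Rightarrow> complex"
  assumes w: "is_weight \<sigma>" and B: "in_Binf \<sigma> \<alpha>" and p: "1 < p" and h: "0 < h"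
    and [measurable]: "f \<in> borel_measurable borel"
    and fin: "(\<integral>\<^sup>+ z. ennreal (norm (f z) powr p) \<partial>weighted \<sigma> \<alpha>) < \<infinity>"
    and A: "0 < A" "2 * 2 powr \<bar>\<alpha>\<bar> * enn2real (Binf_const \<sigma> \<alpha>) \<le> A"
  shows "tree_sum (\<lambda>l h. box_int (weighted \<sigma> \<alpha>) (\<lambda>z. norm (f z)) l h powr p
            * measure (weighted \<sigma> \<alpha>) (hbox l h) powr (1 - p)) n l h
     \<le> A * 2 powr p / (p - 1) * box_int (weighted \<sigma> \<alpha>) (\<lambda>z. norm (f z) powr p) l h"
proof -
  let ?\<nu> = "weighted \<sigma> \<alpha>"
  define s where "s l h = measure ?\<nu> (hbox l h)" for l h
  define F where "F l h = box_int ?\<nu> (\<lambda>z. norm (f z)) l h" for l h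
  define X where "X l h = box_int ?\<nu> (\<lambda>z. norm (f z) powr p) l h" for l h
  \<comment> \<open>The gap between \<open>x powr p\<close> and its tangent at \<open>c\<close>,
    taken at \<open>x = norm (f z)\<close>.\<close>
  define \<phi> where "\<phi> c z = norm (f z) powr p + (p - 1) * c powr p - p * c powr (p - 1) * norm (f z)" for c z
  have \<phi>: "0 \<le> \<phi> c z" if "0 \<le> c" for c z
    using Young_powr[OF p _ that, of "norm (f z)"] by (simp add: \<phi>_def)
  have intF: "integrable ?\<nu> (\<lambda>z. indicator (hbox l h) z * norm (f z))" if "0 < h" for l h
    using nn_integral_norm_finite[OF w B p that _ fin] by (intro ennreal_box_int) auto
  have "(\<integral>\<^sup>+ z. ennreal (norm (f z) powr p) * indicator (hbox l h) z \<partial>?\<nu>)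
     \<le> (\<integral>\<^sup>+ z. ennreal (norm (f z) powr p) \<partial>?\<nu>)" for l h
    by (intro nn_integral_mono) (auto simp: indicator_def)
  then have intX: "integrable ?\<nu> (\<lambda>z. indicator (hbox l h) z * norm (f z) powr p)" for l h
    using fin by (intro ennreal_box_int) (auto intro: le_less_trans)
  have ints: "integrable ?\<nu> (indicator (hbox l h) :: complex \<Rightarrow> real)" if "0 < h" for l h
    using emeasure_hbox_finite[OF w B that] by (intro integrable_real_indicator) auto
  have int\<phi>: "integrable ?\<nu> (\<lambda>z. indicator (hbox l h) z * \<phi> c z)"
    and \<Psi>: "X l h + (p - 1) * c powr p * s l h - p * c powr (p - 1) * F l h
       = (\<integral> z. indicator (hbox l h) z * \<phi> c z \<partial>?\<nu>)" if "0 < h" for c l h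
  proof -
    have eq: "(\<lambda>z. indicator (hbox l h) z * \<phi> c z)
      = (\<lambda>z. indicator (hbox l h) z * norm (f z) powr p + ((p - 1) * c powr p) * indicator (hbox l h) z
           - (p * c powr (p - 1)) * (indicator (hbox l h) z * norm (f z)))"
      by (auto simp: \<phi>_def algebra_simps)
    show "integrable ?\<nu> (\<lambda>z. indicator (hbox l h) z * \<phi> c z)"
      unfolding eq using that intF intX ints by (intro Bochner_Integration.integrable_diff Bochner_Integration.integrable_add integrable_mult_right) auto
    have "(\<integral> z. indicator (hbox l h) z * \<phi> c z \<partial>?\<nu>)
        = (\<integral> z. indicator (hbox l h) z * norm (f z) powr p \<partial>?\<nu>)
         + ((p - 1) * c powr p) * (\<integral> z. indicator (hbox l h) z \<partial>?\<nu>)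
         - (p * c powr (p - 1)) * (\<integral> z. indicator (hbox l h) z * norm (f z) \<partial>?\<nu>)"
      unfolding eq using that intF[OF that, of l] intX[of l h] ints[OF that, of l] by simp
    then show "X l h + (p - 1) * c powr p * s l h - p * c powr (p - 1) * F l h
       = (\<integral> z. indicator (hbox l h) z * \<phi> c z \<partial>?\<nu>)"
      by (simp add: X_def F_def s_def box_int_def)
  qed
  show ?thesis
    unfolding s_def[symmetric] F_def[symmetric] X_def[symmetric]
  proof (rule Carleson_embedding[where s = s and F = F and X = X])
    fix l h :: real assume h: "0 < h"
    show "0 \<le> s l h" by (simp add: s_def)
    show "0 \<le> F l h" by (simp add: F_def box_int_def)
    show "F l h = 0" if "s l h = 0"
    proof -
      have "emeasure ?\<nu> (hbox l h) = 0"
        using that emeasure_hbox_finite[OF w B h, of l] by (auto simp: s_def measure_def enn2real_eq_0_iff)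
      then show ?thesis unfolding F_def by (rule box_int_null) simp
    qed
    show "tree_sum s n l h \<le> A * s l h" for n
    proof -
      have "tree_sum s n l h \<le> 2 * 2 powr \<bar>\<alpha>\<bar> * enn2real (Binf_const \<sigma> \<alpha>) * s l h"
        unfolding s_def by (rule Carleson_weight[OF w B h])
      also have "\<dots> \<le> A * s l h" using A by (intro mult_right_mono) (auto simp: s_def)
      finally show ?thesis .
    qed
    fix c :: real assume c: "0 \<le> c"
    show "0 \<le> X l h + (p - 1) * c powr p * s l h - p * c powr (p - 1) * F l h"
      unfolding \<Psi>[OF h] using \<phi>[OF c] by (intro integral_nonneg_AE) auto
    have h2: "0 < h / 2" using h by simp
    show "X l (h / 2) + (p - 1) * c powr p * s l (h / 2) - p * c powr (p - 1) * F l (h / 2)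
       + (X (l + h / 2) (h / 2) + (p - 1) * c powr p * s (l + h / 2) (h / 2)
           - p * c powr (p - 1) * F (l + h / 2) (h / 2))
       \<le> X l h + (p - 1) * c powr p * s l h - p * c powr (p - 1) * F l h"
      unfolding \<Psi>[OF h] \<Psi>[OF h2]
      unfolding Bochner_Integration.integral_add[OF int\<phi>[OF h2] int\<phi>[OF h2], symmetric]
    proof (rule integral_mono)
      fix z
      show "indicator (hbox l (h / 2)) z * \<phi> c z + indicator (hbox (l + h / 2) (h / 2)) z * \<phi> c z
          \<le> indicator (hbox l h) z * \<phi> c z"
        using \<phi>[OF c, of z] hbox_split[OF h, of l] by (auto simp: indicator_def)
    qed (use int\<phi> h h2 in auto)
  qed (use p A h in auto)
qed

section \<open>Two shifted dyadic grids\<close>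

definition grid_shift :: "int \<Rightarrow> int \<Rightarrow> int" where
  "grid_shift t j = (if even j then t else - t)"

text \<open>The sign alternates with the scale because a third of a step is two thirds of a step of the
  next finer grid, that is, a whole finer step minus a third of one: this makes the shifted grids
  nested.\<close>

definition grid_pt :: "int \<Rightarrow> int \<Rightarrow> int \<Rightarrow> real" where
  "grid_pt t j m = (of_int m + of_int (grid_shift t j) / 3) * 2 powr of_int j"

text \<open>With \<open>s = grid_shift t j\<close> the finer grid is shifted by
  \<open>- s / 3\<close>, and \<open>s - s / 3 = 2 * s / 3\<close>; this is why \<open>s\<close> is
  added to the child index.\<close>

lemma grid_pt_children:
  "grid_pt t (j - 1) (2 * m + grid_shift t j) = grid_pt t j m"
  "grid_pt t (j - 1) (2 * m + grid_shift t j + 1) = grid_pt t j m + 2 powr of_int j / 2"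
  by (auto simp: grid_pt_def grid_shift_def powr_diff field_simps)

text \<open>If neither grid had a cell containing the interval, each would have a cell boundary in
  \<open>(a, b]\<close>. But boundaries of the two grids are at least a third of a cell apart, and
  the interval is at most a third of a cell long.\<close>

lemma grid_cover:
  assumes "a < b"
  shows "\<exists>t\<in>{0, 1}. \<exists>j m. Qbox a b \<subseteq> hbox (grid_pt t j m) (2 powr of_int j)
     \<and> 2 powr of_int j \<le> 6 * (b - a)"
proof -
  \<comment> \<open>The least power of two above \<open>3 * (b - a)\<close>; rounding up costs a
    factor 2, whence the 6.\<close>
  define j where "j = \<lceil>log 2 (3 * (b - a))\<rceil>"
  define H where "H = (2::real) powr of_int j"
  have H: "0 < H" by (simp add: H_def)
  have H1: "3 * (b - a) \<le> H"
  proof -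
    have "2 powr (log 2 (3 * (b - a))) \<le> 2 powr of_int j" by (intro powr_mono) (auto simp: j_def)
    then show ?thesis using assms by (simp add: H_def)
  qed
  have H2: "H \<le> 6 * (b - a)"
  proof -
    have "of_int j \<le> log 2 (3 * (b - a)) + 1" unfolding j_def by linarith
    then have "2 powr of_int j \<le> 2 powr (log 2 (3 * (b - a)) + 1)" by (intro powr_mono) auto
    also have "\<dots> = 6 * (b - a)" using assms by (simp add: powr_add)
    finally show ?thesis by (simp add: H_def)
  qed
  define m where "m t = \<lfloor>a / H - of_int (grid_shift t j) / 3\<rfloor>" for t
  have gp: "grid_pt t j (m t) \<le> a" "a < grid_pt t j (m t) + H" for t
  proof -
    have "of_int (m t) \<le> a / H - of_int (grid_shift t j) / 3"
      "a / H - of_int (grid_shift t j) / 3 < of_int (m t) + 1" unfolding m_def by linarith+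
    then show "grid_pt t j (m t) \<le> a" "a < grid_pt t j (m t) + H"
      using H by (auto simp: grid_pt_def H_def[symmetric] field_simps)
  qed
  have "\<exists>t\<in>{0, 1}. b < grid_pt t j (m t) + H"
  proof (rule ccontr)
    assume "\<not> ?thesis"
    \<comment> \<open>Both right ends lie strictly to the right of \<open>a\<close>, so their
      distance is strictly less than \<open>b - a\<close>.\<close>
    then have "grid_pt 0 j (m 0) + H \<le> b" "grid_pt 1 j (m 1) + H \<le> b" by auto
    with gp[of 0] gp[of 1] have "\<bar>grid_pt 0 j (m 0) - grid_pt 1 j (m 1)\<bar> < b - a" by linarith
    also have "\<dots> \<le> H / 3" using H1 by simp
    finally have lt: "\<bar>grid_pt 0 j (m 0) - grid_pt 1 j (m 1)\<bar> < H / 3" .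
    \<comment> \<open>The integer factor is not divisible by 3, hence not 0.\<close>
    have "grid_pt 0 j (m 0) - grid_pt 1 j (m 1) = of_int (3 * (m 0 - m 1) - grid_shift 1 j) * (H / 3)"
      by (simp add: grid_pt_def H_def[symmetric] grid_shift_def algebra_simps)
    with lt have "\<bar>of_int (3 * (m 0 - m 1) - grid_shift 1 j) * (H / 3)\<bar> < 1 * (H / 3)"
      by simp
    then have "\<bar>real_of_int (3 * (m 0 - m 1) - grid_shift 1 j)\<bar> * (H / 3) < 1 * (H / 3)"
      using H by (simp only: abs_mult)
    then have "\<bar>real_of_int (3 * (m 0 - m 1) - grid_shift 1 j)\<bar> < 1"
      using H by (simp only: mult_less_cancel_right)
    then have "3 * (m 0 - m 1) = grid_shift 1 j" by linarith
    moreover have "grid_shift 1 j = 1 \<or> grid_shift 1 j = - 1" by (simp add: grid_shift_def)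
    ultimately show False by presburger
  qed
  then obtain t where t: "t \<in> {0, 1}" "b < grid_pt t j (m t) + H" by blast
  have "Qbox a b \<subseteq> hbox (grid_pt t j (m t)) H"
    using t gp[of t] H1 assms by (auto simp: Qbox_def hbox_def)
  with t H2 show ?thesis unfolding H_def by blast
qed

text \<open>Reassembles the left and right children of all boxes of one generation into the next
  generation; \<open>e\<close> is the offset of the child index.\<close>

lemma nn_integral_int_split:
  fixes \<phi> :: "int \<Rightarrow> ennreal"
  shows "(\<integral>\<^sup>+ m. \<phi> (2 * m + e) \<partial>count_space UNIV) + (\<integral>\<^sup>+ m. \<phi> (2 * m + e + 1) \<partial>count_space UNIV)
     = (\<integral>\<^sup>+ m. \<phi> m \<partial>count_space UNIV)"
proof -
  let ?A = "{m. even (m - e)}"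
  have 1: "bij_betw (\<lambda>m. 2 * m + e) UNIV ?A"
    by (rule bij_betw_byWitness[where f' = "\<lambda>m. (m - e) div 2"]) auto
  have 2: "bij_betw (\<lambda>m. 2 * m + e + 1) UNIV (- ?A)"
    by (rule bij_betw_byWitness[where f' = "\<lambda>m. (m - e - 1) div 2"]) auto
  have "(\<integral>\<^sup>+ m. \<phi> m \<partial>count_space UNIV) = (\<integral>\<^sup>+ m. \<phi> m * indicator ?A m + \<phi> m * indicator (- ?A) m \<partial>count_space UNIV)"
    by (intro nn_integral_cong) (auto simp: indicator_def)
  also have "\<dots> = (\<integral>\<^sup>+ m. \<phi> m * indicator ?A m \<partial>count_space UNIV) + (\<integral>\<^sup>+ m. \<phi> m * indicator (- ?A) m \<partial>count_space UNIV)"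
    by (rule nn_integral_add) auto
  also have "\<dots> = (\<integral>\<^sup>+ m. \<phi> m \<partial>count_space ?A) + (\<integral>\<^sup>+ m. \<phi> m \<partial>count_space (- ?A))"
    by (simp add: nn_integral_count_space_indicator)
  also have "\<dots> = (\<integral>\<^sup>+ m. \<phi> (2 * m + e) \<partial>count_space UNIV) + (\<integral>\<^sup>+ m. \<phi> (2 * m + e + 1) \<partial>count_space UNIV)"
    using nn_integral_bij_count_space[OF 1, of \<phi>] nn_integral_bij_count_space[OF 2, of \<phi>] by simp
  finally show ?thesis by simp
qed

text \<open>A grid has no top generation. Trees of depth \<open>n\<close> hung from all boxes of
  generation \<open>j\<close> exhaust the generations \<open>j\<close> down to
  \<open>j - n + 1\<close>, and \<open>Y\<close> bounds their total whatever \<open>j\<close> and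
  \<open>n\<close> are, so the roots can be sent to infinite scale.\<close>

lemma grid_sum_le:
  fixes g X :: "real \<Rightarrow> real \<Rightarrow> ennreal"
  assumes tree: "\<And>n l h. 0 < h \<Longrightarrow> tree_sum g n l h \<le> X l h"
    and X: "\<And>j. (\<integral>\<^sup>+ m. X (grid_pt t j m) (2 powr of_int j) \<partial>count_space UNIV) \<le> Y"
  shows "(\<integral>\<^sup>+ j. \<integral>\<^sup>+ m. g (grid_pt t j m) (2 powr of_int j) \<partial>count_space UNIV \<partial>count_space UNIV) \<le> Y"
proof -
  define W where "W j = (\<integral>\<^sup>+ m. g (grid_pt t j m) (2 powr of_int j) \<partial>count_space UNIV)" for j
  define G where "G n j = (\<integral>\<^sup>+ m. tree_sum g n (grid_pt t j m) (2 powr of_int j) \<partial>count_space UNIV)" for n j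
  have G_Suc: "G (Suc n) j = W j + G n (j - 1)" for n j
  proof -
    have half: "2 powr of_int j / 2 = (2::real) powr of_int (j - 1)" by (simp add: powr_diff)
    define \<phi> where "\<phi> m = tree_sum g n (grid_pt t (j - 1) m) (2 powr of_int (j - 1))" for m
    have "G (Suc n) j = W j + ((\<integral>\<^sup>+ m. tree_sum g n (grid_pt t j m) (2 powr of_int j / 2) \<partial>count_space UNIV)
       + (\<integral>\<^sup>+ m. tree_sum g n (grid_pt t j m + 2 powr of_int j / 2) (2 powr of_int j / 2) \<partial>count_space UNIV))"
      by (simp add: G_def W_def nn_integral_add add.assoc)
    also have "\<dots> = W j + ((\<integral>\<^sup>+ m. \<phi> (2 * m + grid_shift t j) \<partial>count_space UNIV)
       + (\<integral>\<^sup>+ m. \<phi> (2 * m + grid_shift t j + 1) \<partial>count_space UNIV))"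
      unfolding \<phi>_def grid_pt_children half ..
    also have "\<dots> = W j + G n (j - 1)"
      unfolding nn_integral_int_split by (simp add: \<phi>_def[abs_def] G_def)
    finally show ?thesis .
  qed
  have G_eq: "G n j = (\<Sum>i<n. W (j - int i))" for n j
  proof (induction n arbitrary: j)
    case 0 then show ?case by (simp add: G_def)
  next
    case (Suc n)
    then show ?case unfolding G_Suc sum.lessThan_Suc_shift by (simp add: algebra_simps)
  qed
  \<comment> \<open>Depth \<open>2 * k + 1\<close> from scale \<open>k\<close> covers precisely the
    window of scales from \<open>- k\<close> to \<open>k\<close>.\<close>
  have fin: "(\<Sum>j\<in>{- int k..int k}. W j) \<le> Y" for k
  proof -
    have "(\<Sum>j\<in>{- int k..int k}. W j) = (\<Sum>i<2 * k + 1. W (int k - int i))"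
      by (rule sum.reindex_bij_witness[where i = "\<lambda>i. int k - int i" and j = "\<lambda>j. nat (int k - j)"]) auto
    also have "\<dots> = G (2 * k + 1) (int k)" by (simp add: G_eq)
    also have "\<dots> \<le> (\<integral>\<^sup>+ m. X (grid_pt t (int k) m) (2 powr of_int (int k)) \<partial>count_space UNIV)"
      unfolding G_def by (intro nn_integral_mono tree) auto
    also have "\<dots> \<le> Y" by (rule X)
    finally show ?thesis .
  qed
  have "(\<integral>\<^sup>+ j. W j \<partial>count_space UNIV) = (\<integral>\<^sup>+ j. (SUP k. W j * indicator {- int k..int k} j) \<partial>count_space UNIV)"
  proof (intro nn_integral_cong antisym)
    fix j
    show "W j \<le> (SUP k. W j * indicator {- int k..int k} j)"
      by (intro SUP_upper2[of "nat \<bar>j\<bar>"]) (auto simp: indicator_def)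
    show "(SUP k. W j * indicator {- int k..int k} j) \<le> W j"
      by (intro SUP_least) (auto simp: indicator_def)
  qed
  also have "\<dots> = (SUP k. \<integral>\<^sup>+ j. W j * indicator {- int k..int k} j \<partial>count_space UNIV)"
    by (intro nn_integral_monotone_convergence_SUP) (auto simp: incseq_def le_fun_def indicator_def)
  also have "\<dots> \<le> Y"
  proof (intro SUP_least)
    fix k
    have "(\<integral>\<^sup>+ j. W j * indicator {- int k..int k} j \<partial>count_space UNIV) = (\<Sum>j\<in>{- int k..int k}. W j)"
      by (simp add: nn_integral_count_space_indicator[symmetric] nn_integral_count_space_finite)
    then show "(\<integral>\<^sup>+ j. W j * indicator {- int k..int k} j \<partial>count_space UNIV) \<le> Y" using fin by simp
  qed
  finally show ?thesis by (simp add: W_def)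
qed

lemma grid_disjoint:
  assumes "z \<in> hbox (grid_pt t j m) (2 powr of_int j)" "z \<in> hbox (grid_pt t j m') (2 powr of_int j)"
  shows "m = m'"
proof -
  define H where "H = (2::real) powr of_int j"
  have H: "H > 0" by (simp add: H_def)
  have "\<bar>grid_pt t j m - grid_pt t j m'\<bar> < H"
    using assms by (auto simp: hbox_def H_def)
  also have "grid_pt t j m - grid_pt t j m' = of_int (m - m') * H"
    by (simp add: grid_pt_def H_def algebra_simps)
  finally have "\<bar>real_of_int (m - m')\<bar> * H < 1 * H" using H by (simp add: abs_mult)
  then have "\<bar>real_of_int (m - m')\<bar> < 1" using H by (simp add: mult_less_cancel_right)
  then show ?thesis by linarith
qed

text \<open>Boxes of one generation are disjoint, so every point is counted at most once.\<close>

lemma grid_integral_le: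
  assumes [measurable]: "\<phi> \<in> borel_measurable M" and [measurable_cong]: "sets M = sets borel"
  shows "(\<integral>\<^sup>+ m. (\<integral>\<^sup>+ z. \<phi> z * indicator (hbox (grid_pt t j m) (2 powr of_int j)) z \<partial>M) \<partial>count_space UNIV)
     \<le> (\<integral>\<^sup>+ z. \<phi> z \<partial>M)"
proof -
  have "(\<integral>\<^sup>+ m. (\<integral>\<^sup>+ z. \<phi> z * indicator (hbox (grid_pt t j m) (2 powr of_int j)) z \<partial>M) \<partial>count_space UNIV)
     = (\<integral>\<^sup>+ z. (\<integral>\<^sup>+ m. \<phi> z * indicator (hbox (grid_pt t j m) (2 powr of_int j)) z \<partial>count_space UNIV) \<partial>M)"
    by (rule nn_integral_count_space_nn_integral[symmetric]) auto
  also have "\<dots> \<le> (\<integral>\<^sup>+ z. \<phi> z \<partial>M)"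
  proof (rule nn_integral_mono)
    fix z
    show "(\<integral>\<^sup>+ m. \<phi> z * indicator (hbox (grid_pt t j m) (2 powr of_int j)) z \<partial>count_space UNIV) \<le> \<phi> z"
    proof (cases "\<exists>m. z \<in> hbox (grid_pt t j m) (2 powr of_int j)")
      case True
      then obtain m0 where m0: "z \<in> hbox (grid_pt t j m0) (2 powr of_int j)" by blast
      have "(\<integral>\<^sup>+ m. \<phi> z * indicator (hbox (grid_pt t j m) (2 powr of_int j)) z \<partial>count_space UNIV)
          = (\<integral>\<^sup>+ m. \<phi> z * indicator {m0} m \<partial>count_space UNIV)"
        using m0 grid_disjoint by (intro nn_integral_cong) (auto simp: indicator_def)
      then show ?thesis by (simp add: nn_integral_cmult_indicator)
    qed simp
  qed
  finally show ?thesis .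
qed

section \<open>Powers and sums of extended reals\<close>

lemma epowr_ennreal [simp]: "0 \<le> x \<Longrightarrow> epowr (ennreal x) r = ennreal (x powr r)"
  by (simp add: epowr_def)

lemma epowr_top [simp]: "epowr \<infinity> r = \<infinity>"
  by (simp add: epowr_def)

lemma epowr_0 [simp]: "epowr 0 r = 0"
  by (simp add: epowr_def)

lemma epowr_mono:
  assumes "0 \<le> r" "x \<le> y"
  shows "epowr x r \<le> epowr y r"
proof (cases y)
  case (real b)
  then obtain a where "x = ennreal a" "0 \<le> a"
    using assms(2) by (cases x) (auto simp: top_unique)
  then show ?thesis using real assms by (auto intro!: ennreal_leI powr_mono2)
next
  case top
  then show ?thesis using epowr_top[of r] by simp
qed

lemma epowr_epowr: "epowr (epowr x a) b = epowr x (a * b)"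
  by (cases x) (auto simp: powr_powr epowr_top[simplified])

lemma epowr_1: "epowr x 1 = x"
  by (cases x) (auto simp: epowr_top[simplified])

text \<open>Valid for every exponent, since \<open>epowr\<close> fixes 0 and \<infinity>, and
  \<open>0 * \<infinity> = 0\<close>.\<close>

lemma epowr_mult: "epowr (x * y) r = epowr x r * epowr y r"
proof (cases x; cases y)
  fix a b assume "x = ennreal a" "y = ennreal b" "0 \<le> a" "0 \<le> b"
  then show ?thesis by (simp add: ennreal_mult[symmetric] powr_mult)
next
  fix a assume *: "x = ennreal a" "y = top" "0 \<le> a"
  then show ?thesis by (cases "a = 0") (auto simp: ennreal_mult_top epowr_top[simplified])
next
  fix b assume *: "x = top" "y = ennreal b" "0 \<le> b"
  then show ?thesis by (cases "b = 0") (auto simp: ennreal_top_mult epowr_top[simplified])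
next
  assume "x = top" "y = top"
  then show ?thesis by (simp add: epowr_top[simplified])
qed

text \<open>No term exceeds the total \<Gamma>, so \<open>g i powr r\<close> is at most
  \<open>g i * \<Gamma> powr (r - 1)\<close>. It is applied with \<open>r = q / p\<close>, where
  \<open>p \<le> q\<close> gives \<open>1 \<le> r\<close>.\<close>

lemma nn_integral_count_space_powr_le:
  fixes g :: "'i \<Rightarrow> real"
  assumes g: "\<And>i. 0 \<le> g i" and r: "1 \<le> r" and \<Gamma>: "0 \<le> \<Gamma>"
    and le: "(\<integral>\<^sup>+ i. ennreal (g i) \<partial>count_space UNIV) \<le> ennreal \<Gamma>"
  shows "(\<integral>\<^sup>+ i. ennreal (g i powr r) \<partial>count_space UNIV) \<le> ennreal (\<Gamma> powr r)"
proof -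
  have split: "x powr r = x * x powr (r - 1)" if "0 \<le> x" for x :: real
    using that by (cases "x = 0") (auto simp: powr_mult_base)
  have "(\<integral>\<^sup>+ i. ennreal (g i powr r) \<partial>count_space UNIV)
      \<le> (\<integral>\<^sup>+ i. ennreal (g i) * ennreal (\<Gamma> powr (r - 1)) \<partial>count_space UNIV)"
  proof (rule nn_integral_mono)
    fix i
    have "ennreal (g i) \<le> ennreal \<Gamma>" by (rule order_trans[OF nn_integral_ge_point le]) simp
    then have "g i powr (r - 1) \<le> \<Gamma> powr (r - 1)" using \<Gamma> g r by (intro powr_mono2) auto
    then have "g i powr r \<le> g i * \<Gamma> powr (r - 1)" using g by (simp add: split mult_left_mono)
    then show "ennreal (g i powr r) \<le> ennreal (g i) * ennreal (\<Gamma> powr (r - 1))"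
      using g by (simp add: ennreal_mult[symmetric] ennreal_leI)
  qed
  also have "\<dots> = (\<integral>\<^sup>+ i. ennreal (g i) \<partial>count_space UNIV) * ennreal (\<Gamma> powr (r - 1))"
    by (rule nn_integral_multc) auto
  also have "\<dots> \<le> ennreal \<Gamma> * ennreal (\<Gamma> powr (r - 1))" by (intro mult_right_mono le) auto
  also have "\<dots> = ennreal (\<Gamma> powr r)" using \<Gamma> by (simp add: split ennreal_mult[symmetric])
  finally show ?thesis .
qed

text \<open>The testing constant uses powers of the volume, the maximal function powers of the
  length. The lower bound serves the sufficiency of the testing condition, the upper bound its
  necessity.\<close>

lemma Qbox_volume_powr:
  fixes \<alpha> q \<gamma> :: real
  assumes "-1 < \<alpha>" "0 \<le> q" "\<gamma> < 2 + \<alpha>"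
  shows "\<exists>k>0. \<exists>K>0. \<forall>a b. a < b \<longrightarrow>
      k * (b - a) powr (- (2 + \<alpha> - \<gamma>) * q)
        \<le> enn2real (emeasure (Valpha \<alpha>) (Qbox a b)) powr (- q * (1 - \<gamma> / (2 + \<alpha>)))
    \<and> enn2real (emeasure (Valpha \<alpha>) (Qbox a b)) powr (- q * (1 - \<gamma> / (2 + \<alpha>)))
        \<le> K * (b - a) powr (- (2 + \<alpha> - \<gamma>) * q)"
proof -
  obtain K where K: "K > 0"
    "\<And>a b. a < b \<Longrightarrow> emeasure (Valpha \<alpha>) (Qbox a b) \<le> ennreal (K * (b - a) powr (2 + \<alpha>))"
    using emeasure_Qbox_le[OF assms(1)] by blast
  define k where "k = 2 powr (- \<bar>\<alpha>\<bar>) / 2"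
  have k: "k > 0" by (simp add: k_def)
  define \<delta> where "\<delta> = q * (1 - \<gamma> / (2 + \<alpha>))"
  have "\<gamma> / (2 + \<alpha>) \<le> 1" using assms by (simp add: field_simps)
  then have \<delta>: "0 \<le> \<delta>" using assms by (simp add: \<delta>_def)
  \<comment> \<open>The exponent \<open>-\<delta>\<close> is at most 0, so the constants swap: the
    upper volume bound \<open>K\<close> yields the lower estimate and \<open>k\<close> the upper
    one.\<close>
  have main: "K powr (-\<delta>) * (b - a) powr (- (2 + \<alpha> - \<gamma>) * q)
        \<le> enn2real (emeasure (Valpha \<alpha>) (Qbox a b)) powr (-\<delta>)
    \<and> enn2real (emeasure (Valpha \<alpha>) (Qbox a b)) powr (-\<delta>)
        \<le> k powr (-\<delta>) * (b - a) powr (- (2 + \<alpha> - \<gamma>) * q)" if "a < b" for a b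
  proof -
    define h where "h = b - a"
    define v where "v = enn2real (emeasure (Valpha \<alpha>) (Qbox a b))"
    have h: "0 < h" using that by (simp add: h_def)
    have ev: "emeasure (Valpha \<alpha>) (Qbox a b) = ennreal v"
      using le_less_trans[OF K(2)[OF that] ennreal_less_top] by (simp add: v_def)
    have v0: "0 \<le> v" by (simp add: v_def)
    have "ennreal v \<le> ennreal (K * h powr (2 + \<alpha>))" using K(2)[OF that] unfolding ev h_def .
    then have v2: "v \<le> K * h powr (2 + \<alpha>)" using K by (simp add: ennreal_le_iff)
    have "ennreal (k * h powr (2 + \<alpha>)) \<le> emeasure (Valpha \<alpha>) (tbox a h)"
      unfolding k_def by (rule emeasure_tbox_ge[OF h])
    also have "\<dots> \<le> emeasure (Valpha \<alpha>) (Qbox a b)"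
      using h by (intro emeasure_mono) (auto simp: tbox_def Qbox_def h_def)
    finally have v1: "k * h powr (2 + \<alpha>) \<le> v"
      by (simp add: ev ennreal_le_iff v0)
    have pos: "0 < k * h powr (2 + \<alpha>)" "0 < v" using k h v1 by (auto intro: less_le_trans[OF _ v1])
    have ex: "(2 + \<alpha>) * -\<delta> = - (2 + \<alpha> - \<gamma>) * q" using assms by (simp add: \<delta>_def field_simps)
    have "(c * h powr (2 + \<alpha>)) powr (-\<delta>) = c powr (-\<delta>) * h powr (- (2 + \<alpha> - \<gamma>) * q)" if "0 < c" for c
      using that by (subst powr_mult) (simp_all only: powr_powr ex)
    moreover have "v powr (-\<delta>) \<le> (k * h powr (2 + \<alpha>)) powr (-\<delta>)"
      using v1 pos \<delta> by (intro powr_mono2') auto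
    moreover have "(K * h powr (2 + \<alpha>)) powr (-\<delta>) \<le> v powr (-\<delta>)"
      using v2 pos \<delta> by (intro powr_mono2') auto
    ultimately show ?thesis using k K by (simp add: v_def h_def)
  qed
  have "0 < K powr (-\<delta>)" "0 < k powr (-\<delta>)" using k K by auto
  moreover have "- \<delta> = - q * (1 - \<gamma> / (2 + \<alpha>))" by (simp add: \<delta>_def)
  ultimately show ?thesis using main by metis
qed

text \<open>\<open>weighted_embedding\<close> asks for a positive constant. If
  \<open>Binf_const\<close> is 0, all masses vanish, and so does every term because
  \<open>0 powr (1 - p) = 0\<close>.\<close>

lemma weighted_embedding_Binf:
  fixes f :: "complex \<Rightarrow> complex"
  assumes w: "is_weight \<sigma>" and B: "in_Binf \<sigma> \<alpha>" and p: "1 < p" and h: "0 < h"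
    and f: "f \<in> borel_measurable borel"
    and fin: "(\<integral>\<^sup>+ z. ennreal (norm (f z) powr p) \<partial>weighted \<sigma> \<alpha>) < \<infinity>"
  shows "tree_sum (\<lambda>l h. box_int (weighted \<sigma> \<alpha>) (\<lambda>z. norm (f z)) l h powr p
            * measure (weighted \<sigma> \<alpha>) (hbox l h) powr (1 - p)) n l h
     \<le> 2 * 2 powr \<bar>\<alpha>\<bar> * enn2real (Binf_const \<sigma> \<alpha>) * 2 powr p / (p - 1)
        * box_int (weighted \<sigma> \<alpha>) (\<lambda>z. norm (f z) powr p) l h"
proof (cases "enn2real (Binf_const \<sigma> \<alpha>) = 0")
  case True
  have "measure (weighted \<sigma> \<alpha>) (hbox l h) = 0" if "0 < h" for l h
    using Carleson_weight[OF w B that, of "Suc 0" l] True measure_nonneg[of "weighted \<sigma> \<alpha>" "hbox l h"]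
    by simp
  then have "tree_sum (\<lambda>l h. box_int (weighted \<sigma> \<alpha>) (\<lambda>z. norm (f z)) l h powr p
            * measure (weighted \<sigma> \<alpha>) (hbox l h) powr (1 - p)) n l h \<le> tree_sum (\<lambda>l h. 0) n l h"
    using h by (intro tree_sum_mono) auto
  also have "\<dots> = 0" by (rule tree_sum_zero)
  finally show ?thesis using True by simp
next
  case False
  then show ?thesis
    by (intro weighted_embedding[OF w B p h f fin]) (auto simp: less_le)
qed

section \<open>Domination by dyadic sums\<close>

lemma hbox_sets_restrict: "sets \<mu> = sets (restrict_space borel UHP) \<Longrightarrow> hbox l h \<in> sets \<mu>"
  by (auto simp: sets_restrict_space_iff)
     (auto simp: hbox_def UHP_def)

lemma Qbox_sets_restrict: "sets \<mu> = sets (restrict_space borel UHP) \<Longrightarrow> Qbox a b \<in> sets \<mu>"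
  by (auto simp: sets_restrict_space_iff)
     (auto simp: Qbox_def UHP_def)

lemma wnorm_eq:
  assumes "is_weight \<sigma>" "f \<in> borel_measurable borel"
  shows "wnorm p \<sigma> \<alpha> f = epowr (\<integral>\<^sup>+ z. ennreal (norm (f z) powr p) \<partial>weighted \<sigma> \<alpha>) (1 / p)"
  unfolding wnorm_def nn_integral_powr_weighted[OF assms] ..

lemma in_Lp_finite:
  assumes "is_weight \<sigma>" "in_Lp p \<sigma> \<alpha> f"
  shows "f \<in> borel_measurable borel" "(\<integral>\<^sup>+ z. ennreal (norm (f z) powr p) \<partial>weighted \<sigma> \<alpha>) < \<infinity>"
proof -
  show f: "f \<in> borel_measurable borel" using assms(2) by (simp add: in_Lp_def)
  show "(\<integral>\<^sup>+ z. ennreal (norm (f z) powr p) \<partial>weighted \<sigma> \<alpha>) < \<infinity>"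
    using assms(2) unfolding in_Lp_def wnorm_eq[OF assms(1) f] epowr_def
    by (auto simp: less_top[symmetric])
qed

definition grid_left :: "int \<Rightarrow> int \<times> int \<Rightarrow> real" where
  "grid_left t i = grid_pt t (fst i) (snd i)"

definition grid_len :: "int \<times> int \<Rightarrow> real" where
  "grid_len i = 2 powr of_int (fst i)"

lemma grid_len_pos [simp]: "0 < grid_len i"
  by (simp add: grid_len_def)

text \<open>\<open>c\<close> is the product of the top-half constant and the constant
  \<open>2 powr p / (p - 1)\<close> of the embedding. The embedding bounds the sum linearly in
  \<open>Binf_const\<close>; only then is the power \<open>q / p\<close> taken.\<close>

lemma grid_sum_powr_le:
  fixes f :: "complex \<Rightarrow> complex" and c p \<alpha> :: real
  defines "c \<equiv> 2 * 2 powr \<bar>\<alpha>\<bar> * 2 powr p / (p - 1)"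
  assumes w: "is_weight \<sigma>" and B: "in_Binf \<sigma> \<alpha>" and p: "1 < p" and pq: "p \<le> q"
    and f: "f \<in> borel_measurable borel"
    and fin: "(\<integral>\<^sup>+ z. ennreal (norm (f z) powr p) \<partial>weighted \<sigma> \<alpha>) < \<infinity>"
  shows "(\<integral>\<^sup>+ i. ennreal ((box_int (weighted \<sigma> \<alpha>) (\<lambda>z. norm (f z)) (grid_left t i) (grid_len i) powr p
            * measure (weighted \<sigma> \<alpha>) (hbox (grid_left t i) (grid_len i)) powr (1 - p)) powr (q / p)) \<partial>count_space UNIV)
     \<le> epowr (ennreal c * Binf_const \<sigma> \<alpha> * (\<integral>\<^sup>+ z. ennreal (norm (f z) powr p) \<partial>weighted \<sigma> \<alpha>)) (q / p)"
proof -
  let ?\<nu> = "weighted \<sigma> \<alpha>"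
  note [measurable] = f
  define g where "g l h = box_int ?\<nu> (\<lambda>z. norm (f z)) l h powr p * measure ?\<nu> (hbox l h) powr (1 - p)" for l h
  define Y where "Y = enn2real (\<integral>\<^sup>+ z. ennreal (norm (f z) powr p) \<partial>?\<nu>)"
  define B where "B = enn2real (Binf_const \<sigma> \<alpha>)"
  have c: "0 < c" using p by (simp add: c_def)
  have eY: "(\<integral>\<^sup>+ z. ennreal (norm (f z) powr p) \<partial>?\<nu>) = ennreal Y"
    using fin by (simp add: Y_def)
  have eB: "Binf_const \<sigma> \<alpha> = ennreal B"
    using \<open>in_Binf \<sigma> \<alpha>\<close> by (simp add: B_def in_Binf_def)
  have YB: "0 \<le> Y" "0 \<le> B" by (simp_all add: Y_def B_def)
  define X where "X l h = ennreal (c * B) * (\<integral>\<^sup>+ z. ennreal (norm (f z) powr p) * indicator (hbox l h) z \<partial>?\<nu>)" for l h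
  have tree: "tree_sum (\<lambda>l h. ennreal (g l h)) n l h \<le> X l h" if h: "0 < h" for n l h
  proof -
    have le: "(\<integral>\<^sup>+ z. ennreal (norm (f z) powr p) * indicator (hbox l h) z \<partial>?\<nu>)
       \<le> (\<integral>\<^sup>+ z. ennreal (norm (f z) powr p) \<partial>?\<nu>)"
      by (intro nn_integral_mono) (auto simp: indicator_def)
    have "tree_sum (\<lambda>l h. ennreal (g l h)) n l h = ennreal (tree_sum g n l h)"
      using h by (intro ennreal_tree_sum[symmetric]) (auto simp: g_def)
    also have "tree_sum g n l h \<le> c * B * box_int ?\<nu> (\<lambda>z. norm (f z) powr p) l h"
      using weighted_embedding_Binf[OF w \<open>in_Binf \<sigma> \<alpha>\<close> p h f fin, of n l]
      by (simp add: g_def[abs_def] c_def B_def mult_ac)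
    also have "ennreal (c * B * box_int ?\<nu> (\<lambda>z. norm (f z) powr p) l h) = X l h"
    proof -
      have "ennreal (box_int ?\<nu> (\<lambda>z. norm (f z) powr p) l h)
          = (\<integral>\<^sup>+ z. ennreal (norm (f z) powr p) * indicator (hbox l h) z \<partial>?\<nu>)"
        by (rule ennreal_box_int(1)[OF _ _ _ le_less_trans[OF le fin]]) auto
      then show ?thesis
        unfolding X_def using c YB by (simp add: ennreal_mult' ennreal_mult'')
    qed
    finally show ?thesis by (simp add: ennreal_leI)
  qed
  have "(\<integral>\<^sup>+ i. ennreal (g (grid_left t i) (grid_len i)) \<partial>count_space UNIV)
      = (\<integral>\<^sup>+ j. \<integral>\<^sup>+ m. ennreal (g (grid_pt t j m) (2 powr of_int j)) \<partial>count_space UNIV \<partial>count_space UNIV)"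
    by (subst nn_integral_fst_count_space[symmetric]) (simp add: grid_left_def grid_len_def)
  also have "\<dots> \<le> ennreal (c * B) * ennreal Y"
  proof (rule grid_sum_le[OF tree])
    fix j
    have "(\<integral>\<^sup>+ m. X (grid_pt t j m) (2 powr of_int j) \<partial>count_space UNIV)
       = ennreal (c * B) * (\<integral>\<^sup>+ m. (\<integral>\<^sup>+ z. ennreal (norm (f z) powr p)
             * indicator (hbox (grid_pt t j m) (2 powr of_int j)) z \<partial>?\<nu>) \<partial>count_space UNIV)"
      unfolding X_def by (rule nn_integral_cmult) auto
    also have "\<dots> \<le> ennreal (c * B) * ennreal Y"
      unfolding eY[symmetric] by (intro mult_left_mono grid_integral_le) auto
    finally show "(\<integral>\<^sup>+ m. X (grid_pt t j m) (2 powr of_int j) \<partial>count_space UNIV) \<le> ennreal (c * B) * ennreal Y" .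
  qed
  also have "\<dots> = ennreal (c * B * Y)" using c YB by (simp add: ennreal_mult)
  finally have "(\<integral>\<^sup>+ i. ennreal (g (grid_left t i) (grid_len i) powr (q / p)) \<partial>count_space UNIV)
      \<le> ennreal ((c * B * Y) powr (q / p))"
    using c YB p pq by (intro nn_integral_count_space_powr_le) (auto simp: g_def)
  also have "\<dots> = epowr (ennreal c * Binf_const \<sigma> \<alpha> * (\<integral>\<^sup>+ z. ennreal (norm (f z) powr p) \<partial>?\<nu>)) (q / p)"
    using c YB by (simp add: eY eB ennreal_mult[symmetric])
  finally show ?thesis by (simp add: g_def)
qed

text \<open>Since \<open>(1 - p) * (q / p) = - q / p'\<close>, the power \<open>F powr q\<close>
  splits into the last factor on the right and \<open>s powr (q / p')\<close>, which is the
  \<sigma>-part of the testing constant. What remains is free of \<mu>.\<close>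

lemma sigma_mu_box:
  fixes f :: "complex \<Rightarrow> complex"
  assumes w: "is_weight \<sigma>" and B: "in_Binf \<sigma> \<alpha>" and p: "1 < p" and pq: "p \<le> q" and h: "0 < h"
    and \<mu>: "sets \<mu> = sets (restrict_space borel UHP)" and k: "0 < k"
    and vol: "k * h powr (- \<beta> * q)
        \<le> enn2real (emeasure (Valpha \<alpha>) (Qbox l (l + h))) powr (- q * (1 - \<gamma> / (2 + \<alpha>)))"
  defines "F \<equiv> box_int (weighted \<sigma> \<alpha>) (\<lambda>z. norm (f z)) l h"
  shows "ennreal (h powr (- \<beta> * q) * F powr q) * emeasure \<mu> (hbox l h)
    \<le> ennreal (1 / k) * sigma_mu_const \<sigma> \<mu> p q \<alpha> \<gamma>
       * ennreal ((F powr p * measure (weighted \<sigma> \<alpha>) (hbox l h) powr (1 - p)) powr (q / p))"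
proof -
  define s where "s = measure (weighted \<sigma> \<alpha>) (hbox l h)"
  define v where "v = enn2real (emeasure (Valpha \<alpha>) (Qbox l (l + h))) powr (- q * (1 - \<gamma> / (2 + \<alpha>)))"
  define e where "e = q / (p / (p - 1))"
  define S where "S = sigma_mu_const \<sigma> \<mu> p q \<alpha> \<gamma>"
  have es: "emeasure (weighted \<sigma> \<alpha>) (hbox l h) = ennreal s"
    using emeasure_hbox_finite[OF w B h, of l] unfolding s_def
    by (intro emeasure_eq_ennreal_measure) auto
  have F0: "0 \<le> F" by (simp add: F_def box_int_def)
  have s0: "0 \<le> s" by (simp add: s_def)
  show ?thesis
  proof (cases "s = 0")
    \<comment> \<open>On a null box \<open>F\<close> vanishes together with \<open>s\<close>, so the
      left side is 0.\<close>
    case True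
    then have "F = 0" unfolding F_def by (intro box_int_null) (auto simp: es)
    then show ?thesis using p pq by simp
  next
    case False
    then have s: "0 < s" using s0 by simp
    have 1: "ennreal v * emeasure \<mu> (Qbox l (l + h)) * ennreal (s powr e) \<le> S"
      unfolding S_def sigma_mu_const_def v_def e_def
      using h es s0 by (intro SUP_upper2[of "(l, l + h)"])
        (auto simp: wmeas_eq[OF w] emeasure_hbox_eq_Qbox[OF w, symmetric])
    define G where "G = (F powr p * s powr (1 - p)) powr (q / p)"
    have G: "F powr q = G * s powr e"
      using F0 s p by (simp add: G_def e_def powr_mult powr_powr powr_add[symmetric] field_simps)
    have hv: "h powr (- \<beta> * q) \<le> 1 / k * v" using vol k by (simp add: v_def field_simps)
    have "ennreal (h powr (- \<beta> * q) * F powr q) * emeasure \<mu> (hbox l h)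
        \<le> ennreal (1 / k * v * F powr q) * emeasure \<mu> (Qbox l (l + h))"
      using hv \<mu> by (intro mult_mono ennreal_leI mult_right_mono emeasure_mono Qbox_sets_restrict)
         (auto simp: hbox_def Qbox_def)
    also have "\<dots> = ennreal (1 / k) * (ennreal v * emeasure \<mu> (Qbox l (l + h)) * ennreal (s powr e)) * ennreal G"
    proof -
      have "ennreal (1 / k * v * F powr q) = ennreal (1 / k) * ennreal v * ennreal (s powr e) * ennreal G"
        using k by (simp add: G v_def G_def ennreal_mult[symmetric] mult_ac)
      then show ?thesis by (simp add: mult_ac)
    qed
    also have "\<dots> \<le> ennreal (1 / k) * S * ennreal G"
      by (intro mult_right_mono mult_left_mono 1) auto
    finally show ?thesis by (simp add: S_def G_def s_def)
  qed
qed

lemma Mfrac_le_grid: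
  fixes f :: "complex \<Rightarrow> complex"
  assumes w: "is_weight \<sigma>" and B: "in_Binf \<sigma> \<alpha>" and p: "1 < p" and q: "0 < q"
    and \<gamma>: "\<gamma> < 2 + \<alpha>"
    and f: "f \<in> borel_measurable borel"
    and fin: "(\<integral>\<^sup>+ z. ennreal (norm (f z) powr p) \<partial>weighted \<sigma> \<alpha>) < \<infinity>"
  shows "epowr (Mfrac \<alpha> \<gamma> (wmul \<sigma> f) z) q
    \<le> ennreal (6 powr ((2 + \<alpha> - \<gamma>) * q)) * (\<Sum>t\<in>{0, 1}. \<integral>\<^sup>+ i.
         ennreal (grid_len i powr (- (2 + \<alpha> - \<gamma>) * q)
            * box_int (weighted \<sigma> \<alpha>) (\<lambda>z. norm (f z)) (grid_left t i) (grid_len i) powr q)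
         * indicator (hbox (grid_left t i) (grid_len i)) z \<partial>count_space UNIV)" (is "_ \<le> ?R")
proof -
  note [measurable] = f
  define \<beta> where "\<beta> = 2 + \<alpha> - \<gamma>"
  have \<beta>: "0 < \<beta>" using \<gamma> by (simp add: \<beta>_def)
  have qq: "q * (1 / q) = 1" "1 / q * q = 1" using q by simp_all
  let ?F = "box_int (weighted \<sigma> \<alpha>) (\<lambda>z. norm (f z))"
  \<comment> \<open>Comparing with the \<open>q\<close>-th root of the right side lets each
    competitor in the supremum be treated alone: one grid box covers it, and one term is below the
    whole sum.\<close>
  have "Mfrac \<alpha> \<gamma> (wmul \<sigma> f) z \<le> epowr ?R (1 / q)"
    unfolding Mfrac_def
  proof (intro SUP_least, clarify)
    fix a b :: real assume ab: "a < b" and z: "z \<in> Qbox a b"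
    obtain t j m where t: "t \<in> {0, 1}" and sub: "Qbox a b \<subseteq> hbox (grid_pt t j m) (2 powr of_int j)"
      and len: "2 powr of_int j \<le> 6 * (b - a)"
      using grid_cover[OF ab] by blast
    define i where "i = (j, m)"
    define l where "l = grid_left t i"
    define h where "h = grid_len i"
    have lh: "Qbox a b \<subseteq> hbox l h" "h \<le> 6 * (b - a)" "0 < h"
      using sub len by (auto simp: l_def h_def i_def grid_left_def grid_len_def)
    have F0: "0 \<le> ?F l h" by (simp add: box_int_def)
    let ?T = "ennreal ((b - a) powr - \<beta>) * (\<integral>\<^sup>+ w. ennreal (norm (wmul \<sigma> f w)) * indicator (Qbox a b) w \<partial>Valpha \<alpha>)"
    have "(\<integral>\<^sup>+ w. ennreal (norm (wmul \<sigma> f w)) * indicator (Qbox a b) w \<partial>Valpha \<alpha>)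
        = (\<integral>\<^sup>+ w. ennreal (norm (f w)) * indicator (Qbox a b) w \<partial>weighted \<sigma> \<alpha>)"
      by (rule nn_integral_wmul[OF w f]) simp
    also have "\<dots> \<le> (\<integral>\<^sup>+ w. ennreal (norm (f w)) * indicator (hbox l h) w \<partial>weighted \<sigma> \<alpha>)"
      using lh by (intro nn_integral_mono mult_left_mono) (auto simp: indicator_def)
    also have "\<dots> = ennreal (?F l h)"
      using nn_integral_norm_finite[OF w B p lh(3) f fin, of l] by (intro ennreal_box_int(1)[symmetric]) auto
    finally have "?T \<le> ennreal (6 powr \<beta> * h powr - \<beta>) * ennreal (?F l h)"
    proof (intro mult_mono ennreal_leI)
      have "(b - a) powr - \<beta> \<le> (h / 6) powr - \<beta>"
        using lh ab \<beta> by (intro powr_mono2') auto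
      also have "\<dots> = 6 powr \<beta> * h powr - \<beta>" using lh by (simp add: powr_divide powr_minus field_simps)
      finally show "(b - a) powr - \<beta> \<le> 6 powr \<beta> * h powr - \<beta>" .
    qed auto
    also have "\<dots> = ennreal (6 powr \<beta> * h powr - \<beta> * ?F l h)"
      using F0 by (simp add: ennreal_mult)
    finally have "epowr ?T q \<le> epowr (ennreal (6 powr \<beta> * h powr - \<beta> * ?F l h)) q"
      by (rule epowr_mono[OF less_imp_le[OF q]])
    also have "\<dots> = ennreal (6 powr (\<beta> * q)) * (ennreal (h powr (- \<beta> * q) * ?F l h powr q) * indicator (hbox l h) z)"
    proof -
      have "(6 powr \<beta> * h powr - \<beta> * ?F l h) powr q
          = 6 powr (\<beta> * q) * (h powr (- \<beta> * q) * ?F l h powr q)"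
        by (simp add: powr_mult powr_powr mult.assoc)
      moreover have "0 \<le> 6 powr \<beta> * h powr - \<beta> * ?F l h" using F0 by simp
      moreover have "z \<in> hbox l h" using lh z by blast
      ultimately show ?thesis by (simp only: epowr_ennreal) (simp add: ennreal_mult)
    qed
    also have "\<dots> \<le> ?R"
      unfolding \<beta>_def[symmetric]
    proof (intro mult_left_mono)
      let ?g = "\<lambda>t i. ennreal (grid_len i powr (- \<beta> * q) * ?F (grid_left t i) (grid_len i) powr q)
         * indicator (hbox (grid_left t i) (grid_len i)) z"
      have "ennreal (h powr (- \<beta> * q) * ?F l h powr q) * indicator (hbox l h) z = ?g t i"
        by (simp add: l_def h_def)
      also have "\<dots> \<le> (\<integral>\<^sup>+ i. ?g t i \<partial>count_space UNIV)" by (rule nn_integral_ge_point) simp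
      also have "\<dots> \<le> (\<Sum>t\<in>{0, 1}. \<integral>\<^sup>+ i. ?g t i \<partial>count_space UNIV)"
        using t by (intro member_le_sum) auto
      finally show "ennreal (h powr (- \<beta> * q) * ?F l h powr q) * indicator (hbox l h) z
         \<le> (\<Sum>t\<in>{0, 1}. \<integral>\<^sup>+ i. ?g t i \<partial>count_space UNIV)" .
    qed simp
    finally have "epowr (epowr ?T q) (1 / q) \<le> epowr ?R (1 / q)"
      by (rule epowr_mono[rotated]) (use q in simp)
    then show "ennreal ((b - a) powr - (2 + \<alpha> - \<gamma>)) * (\<integral>\<^sup>+ w. ennreal (norm (wmul \<sigma> f w)) * indicator (Qbox a b) w \<partial>Valpha \<alpha>)
       \<le> epowr ?R (1 / q)"
      unfolding epowr_epowr qq epowr_1 \<beta>_def .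
  qed
  then have "epowr (Mfrac \<alpha> \<gamma> (wmul \<sigma> f) z) q \<le> epowr (epowr ?R (1 / q)) q"
    by (rule epowr_mono[OF less_imp_le[OF q]])
  then show ?thesis unfolding epowr_epowr qq epowr_1 .
qed

section \<open>The two-weight inequality\<close>

lemma Mnorm_mu_le:
  fixes \<alpha> p q \<gamma> :: real
  assumes \<alpha>: "\<alpha> > -1" and p: "1 < p" and pq: "p \<le> q" and \<gamma>: "\<gamma> < 2 + \<alpha>"
  shows "\<exists>C>0. \<forall>\<sigma> \<mu> f. is_weight \<sigma> \<and> sets \<mu> = sets (restrict_space borel UHP) \<and> in_Binf \<sigma> \<alpha>
      \<and> in_Lp p \<sigma> \<alpha> f \<longrightarrow>
            Mnorm_mu \<mu> q \<alpha> \<gamma> (wmul \<sigma> f)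
              \<le> ennreal C * epowr (sigma_mu_const \<sigma> \<mu> p q \<alpha> \<gamma>) (1 / q)
                 * epowr (Binf_const \<sigma> \<alpha>) (1 / p) * wnorm p \<sigma> \<alpha> f"
proof -
  define \<beta> where "\<beta> = 2 + \<alpha> - \<gamma>"
  have q: "0 < q" using p pq by simp
  obtain k where k: "k > 0" "\<And>a b. a < b \<Longrightarrow> k * (b - a) powr (- \<beta> * q)
        \<le> enn2real (emeasure (Valpha \<alpha>) (Qbox a b)) powr (- q * (1 - \<gamma> / (2 + \<alpha>)))"
    using Qbox_volume_powr[OF \<alpha> less_imp_le[OF q] \<gamma>] unfolding \<beta>_def by blast
  define c where "c = 2 * 2 powr \<bar>\<alpha>\<bar> * 2 powr p / (p - 1)"
  have c: "c > 0" using p by (simp add: c_def)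
  \<comment> \<open>\<open>6 powr (\<beta> * q)\<close> from enlarging boxes to grid boxes, 2 for
    the two grids, \<open>1 / k\<close> for length against volume.\<close>
  define D where "D = 6 powr (\<beta> * q) * 2 * (1 / k)"
  have D: "D > 0" using k by (simp add: D_def)
  have "Mnorm_mu \<mu> q \<alpha> \<gamma> (wmul \<sigma> f)
      \<le> ennreal (D powr (1 / q) * c powr (1 / p)) * epowr (sigma_mu_const \<sigma> \<mu> p q \<alpha> \<gamma>) (1 / q)
         * epowr (Binf_const \<sigma> \<alpha>) (1 / p) * wnorm p \<sigma> \<alpha> f"
    if w: "is_weight \<sigma>" and \<mu>: "sets \<mu> = sets (restrict_space borel UHP)" and B: "in_Binf \<sigma> \<alpha>"
      and Lp: "in_Lp p \<sigma> \<alpha> f" for \<sigma> \<mu> f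
  proof -
    note f = in_Lp_finite[OF w Lp]
    define S where "S = sigma_mu_const \<sigma> \<mu> p q \<alpha> \<gamma>"
    define Y where "Y = (\<integral>\<^sup>+ z. ennreal (norm (f z) powr p) \<partial>weighted \<sigma> \<alpha>)"
    define F where "F t i = box_int (weighted \<sigma> \<alpha>) (\<lambda>z. norm (f z)) (grid_left t i) (grid_len i)" for t i
    define J where "J t i = hbox (grid_left t i) (grid_len i)" for t i
    have [measurable]: "J t i \<in> sets \<mu>" for t i unfolding J_def by (rule hbox_sets_restrict[OF \<mu>])
    define T where "T t i = ennreal (grid_len i powr (- \<beta> * q) * F t i powr q)" for t i
    define G where "G t i = (F t i powr p * measure (weighted \<sigma> \<alpha>) (J t i) powr (1 - p)) powr (q / p)" for t i
    define E where "E = epowr (ennreal c * Binf_const \<sigma> \<alpha> * Y) (q / p)"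
    have GE: "(\<integral>\<^sup>+ i. ennreal (G t i) \<partial>count_space UNIV) \<le> E" for t
      using grid_sum_powr_le[OF w B p pq f, of t] unfolding G_def E_def Y_def F_def J_def c_def .
    have TG: "T t i * emeasure \<mu> (J t i) \<le> ennreal (1 / k) * S * ennreal (G t i)" for t i
      unfolding T_def G_def F_def J_def S_def
      by (rule sigma_mu_box[OF w B p pq grid_len_pos \<mu> k(1)])
         (use k(2)[of "grid_left t i" "grid_left t i + grid_len i"] in simp)
    have I: "(\<integral>\<^sup>+ z. (\<integral>\<^sup>+ i. T t i * indicator (J t i) z \<partial>count_space UNIV) \<partial>\<mu>) \<le> ennreal (1 / k) * S * E" for t
    proof -
      \<comment> \<open>The index set is countable, so the exchange holds for any \<mu>,
        sigma-finite or not.\<close>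
      have "(\<integral>\<^sup>+ z. (\<integral>\<^sup>+ i. T t i * indicator (J t i) z \<partial>count_space UNIV) \<partial>\<mu>)
          = (\<integral>\<^sup>+ i. (\<integral>\<^sup>+ z. T t i * indicator (J t i) z \<partial>\<mu>) \<partial>count_space UNIV)"
        by (rule nn_integral_count_space_nn_integral) auto
      also have "\<dots> = (\<integral>\<^sup>+ i. T t i * emeasure \<mu> (J t i) \<partial>count_space UNIV)"
        by (simp add: nn_integral_cmult_indicator)
      also have "\<dots> \<le> (\<integral>\<^sup>+ i. ennreal (1 / k) * S * ennreal (G t i) \<partial>count_space UNIV)"
        by (intro nn_integral_mono TG)
      also have "\<dots> = ennreal (1 / k) * S * (\<integral>\<^sup>+ i. ennreal (G t i) \<partial>count_space UNIV)"
        by (rule nn_integral_cmult) auto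
      also have "\<dots> \<le> ennreal (1 / k) * S * E" by (intro mult_left_mono GE) auto
      finally show ?thesis .
    qed
    have meas: "(\<lambda>z. \<integral>\<^sup>+ i. T t i * indicator (J t i) z \<partial>count_space UNIV) \<in> borel_measurable \<mu>" for t
    proof -
      \<comment> \<open>Enumerating the grid turns the sum into a series of measurable
        functions.\<close>
      have "infinite (UNIV :: (int \<times> int) set)" by (simp add: finite_prod)
      then have bij: "bij_betw (from_nat_into (UNIV :: (int \<times> int) set)) UNIV UNIV"
        by (intro bij_betw_from_nat_into) auto
      show ?thesis
        unfolding nn_integral_bij_count_space[OF bij, symmetric] nn_integral_count_space_nat
        by measurable
    qed
    \<comment> \<open>Monotonicity of the integral suffices, which avoids proving the maximal
      function measurable.\<close>
    have "(\<integral>\<^sup>+ z. epowr (Mfrac \<alpha> \<gamma> (wmul \<sigma> f) z) q \<partial>\<mu>)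
       \<le> (\<integral>\<^sup>+ z. ennreal (6 powr (\<beta> * q)) * (\<Sum>t\<in>{0, 1}. \<integral>\<^sup>+ i. T t i * indicator (J t i) z \<partial>count_space UNIV) \<partial>\<mu>)"
      unfolding \<beta>_def T_def J_def F_def by (intro nn_integral_mono Mfrac_le_grid[OF w B p q \<gamma> f])
    also have "\<dots> = ennreal (6 powr (\<beta> * q))
        * (\<Sum>t\<in>{0, 1}. \<integral>\<^sup>+ z. (\<integral>\<^sup>+ i. T t i * indicator (J t i) z \<partial>count_space UNIV) \<partial>\<mu>)"
      using meas by (simp add: nn_integral_cmult nn_integral_add)
    also have "\<dots> \<le> ennreal (6 powr (\<beta> * q)) * (\<Sum>t\<in>{0, 1::int}. ennreal (1 / k) * S * E)"
      by (intro mult_left_mono sum_mono I) auto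
    also have "\<dots> = ennreal (6 powr (\<beta> * q)) * (2 * (ennreal (1 / k) * (S * E)))"
      by (simp add: mult_2 mult.assoc)
    also have "\<dots> = ennreal D * (S * E)"
    proof -
      have "ennreal D = ennreal (6 powr (\<beta> * q)) * ennreal 2 * ennreal (1 / k)"
        unfolding D_def using k(1)
        by (simp only: ennreal_mult''[of "1 / k"] ennreal_mult''[of 2] zero_le_numeral divide_nonneg_pos zero_le_one)
      then show ?thesis by (simp add: mult.assoc)
    qed
    finally have "Mnorm_mu \<mu> q \<alpha> \<gamma> (wmul \<sigma> f) \<le> epowr (ennreal D * (S * E)) (1 / q)"
      unfolding Mnorm_mu_def by (rule epowr_mono[rotated]) (use q in simp)
    also have "\<dots> = ennreal (D powr (1 / q)) * (epowr S (1 / q) * epowr (ennreal c * Binf_const \<sigma> \<alpha> * Y) (1 / p))"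
      using D q by (simp add: epowr_mult E_def epowr_epowr del: epowr_0)
    also have "\<dots> = ennreal (D powr (1 / q) * c powr (1 / p)) * epowr S (1 / q)
         * epowr (Binf_const \<sigma> \<alpha>) (1 / p) * epowr Y (1 / p)"
      using c by (simp add: epowr_mult ennreal_mult mult_ac)
    also have "epowr Y (1 / p) = wnorm p \<sigma> \<alpha> f" unfolding Y_def wnorm_eq[OF w f(1)] ..
    finally show ?thesis by (simp add: S_def)
  qed
  then show ?thesis using c D by (intro exI[of _ "D powr (1 / q) * c powr (1 / p)"]) auto
qed

text \<open>The inequality is tested on the indicator of a box, where the maximal function is at
  least the box's own term. \<open>in_Binf\<close> makes the mass of the box finite, so the
  indicator is admissible and powers of the mass can be cancelled.\<close>

lemma sigma_mu_const_finite:
  fixes \<alpha> p q \<gamma> :: real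
  assumes \<alpha>: "\<alpha> > -1" and p: "1 < p" and pq: "p \<le> q" and \<gamma>: "\<gamma> < 2 + \<alpha>"
    and w: "is_weight \<sigma>" and \<mu>: "sets \<mu> = sets (restrict_space borel UHP)" and B: "in_Binf \<sigma> \<alpha>"
    and C1: "0 < C1" and bound: "\<And>f. in_Lp p \<sigma> \<alpha> f \<Longrightarrow>
        Mnorm_mu \<mu> q \<alpha> \<gamma> (wmul \<sigma> f) \<le> ennreal C1 * wnorm p \<sigma> \<alpha> f"
  shows "sigma_mu_const \<sigma> \<mu> p q \<alpha> \<gamma> < \<infinity>"
proof -
  define \<beta> where "\<beta> = 2 + \<alpha> - \<gamma>"
  have q: "0 < q" using p pq by simp
  obtain K where K: "K > 0" "\<And>a b. a < b \<Longrightarrow>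
      enn2real (emeasure (Valpha \<alpha>) (Qbox a b)) powr (- q * (1 - \<gamma> / (2 + \<alpha>)))
        \<le> K * (b - a) powr (- \<beta> * q)"
    using Qbox_volume_powr[OF \<alpha> less_imp_le[OF q] \<gamma>] unfolding \<beta>_def by blast
  define e where "e = q / (p / (p - 1))"
  have "sigma_mu_const \<sigma> \<mu> p q \<alpha> \<gamma> \<le> ennreal (K * C1 powr q)"
    unfolding sigma_mu_const_def e_def[symmetric]
  proof (intro SUP_least, clarify)
    fix a b :: real assume ab: "a < b"
    define h where "h = b - a"
    define Q where "Q = Qbox a b"
    have [measurable]: "Q \<in> sets borel" by (simp add: Q_def)
    have Q\<mu>: "Q \<in> sets \<mu>" unfolding Q_def by (rule Qbox_sets_restrict[OF \<mu>])
    define s where "s = measure (weighted \<sigma> \<alpha>) Q"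
    define v where "v = enn2real (emeasure (Valpha \<alpha>) Q) powr (- q * (1 - \<gamma> / (2 + \<alpha>)))"
    have s0: "0 \<le> s" and v0: "0 \<le> v" by (simp_all add: s_def v_def)
    have es: "emeasure (weighted \<sigma> \<alpha>) Q = ennreal s"
      using emeasure_Qbox_finite[OF w B ab] unfolding s_def Q_def
      by (intro emeasure_eq_ennreal_measure) auto
    define f where "f z = complex_of_real (indicator Q z)" for z
    have f: "f \<in> borel_measurable borel" unfolding f_def by measurable
    have "(\<integral>\<^sup>+ z. ennreal (norm (f z) powr p) \<partial>weighted \<sigma> \<alpha>) = (\<integral>\<^sup>+ z. indicator Q z \<partial>weighted \<sigma> \<alpha>)"
      using p by (intro nn_integral_cong) (auto simp: f_def indicator_def)
    then have wn: "wnorm p \<sigma> \<alpha> f = ennreal (s powr (1 / p))"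
      using s0 by (simp add: wnorm_eq[OF w f] es)
    then have Lp: "in_Lp p \<sigma> \<alpha> f" using f by (simp add: in_Lp_def)
    have M: "ennreal (h powr - \<beta> * s) \<le> Mfrac \<alpha> \<gamma> (wmul \<sigma> f) z" if "z \<in> Q" for z
    proof -
      have "(\<integral>\<^sup>+ z. ennreal (norm (wmul \<sigma> f z)) * indicator Q z \<partial>Valpha \<alpha>)
          = (\<integral>\<^sup>+ z. ennreal (norm (f z)) * indicator Q z \<partial>weighted \<sigma> \<alpha>)"
        by (rule nn_integral_wmul[OF w f]) simp
      also have "\<dots> = (\<integral>\<^sup>+ z. indicator Q z \<partial>weighted \<sigma> \<alpha>)"
        by (intro nn_integral_cong) (auto simp: f_def indicator_def)
      also have "\<dots> = ennreal s" by (simp add: es)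
      finally show ?thesis
        unfolding Mfrac_def \<beta>_def[symmetric] using that ab s0
        by (intro SUP_upper2[of "(a, b)"]) (auto simp: Q_def h_def ennreal_mult)
    qed
    have "ennreal (h powr (- \<beta> * q) * s powr q) * emeasure \<mu> Q
        = (\<integral>\<^sup>+ z. ennreal (h powr (- \<beta> * q) * s powr q) * indicator Q z \<partial>\<mu>)"
      using Q\<mu> by (simp add: nn_integral_cmult_indicator)
    also have "\<dots> \<le> (\<integral>\<^sup>+ z. epowr (Mfrac \<alpha> \<gamma> (wmul \<sigma> f) z) q \<partial>\<mu>)"
    proof (rule nn_integral_mono)
      fix z
      have "ennreal (h powr (- \<beta> * q) * s powr q) \<le> epowr (Mfrac \<alpha> \<gamma> (wmul \<sigma> f) z) q" if "z \<in> Q"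
        using epowr_mono[OF less_imp_le[OF q] M[OF that]] s0 by (simp add: powr_mult powr_powr)
      then show "ennreal (h powr (- \<beta> * q) * s powr q) * indicator Q z \<le> epowr (Mfrac \<alpha> \<gamma> (wmul \<sigma> f) z) q"
        by (auto simp: indicator_def)
    qed
    also have "\<dots> = epowr (Mnorm_mu \<mu> q \<alpha> \<gamma> (wmul \<sigma> f)) q"
      using q by (simp add: Mnorm_mu_def epowr_epowr epowr_1)
    also have "\<dots> \<le> epowr (ennreal C1 * wnorm p \<sigma> \<alpha> f) q"
      by (intro epowr_mono bound Lp less_imp_le[OF q])
    also have "\<dots> = ennreal (C1 powr q * s powr (q / p))"
      using C1 by (simp add: wn epowr_mult powr_powr ennreal_mult)
    finally have main: "ennreal (h powr (- \<beta> * q) * s powr q) * emeasure \<mu> Q \<le> ennreal (C1 powr q * s powr (q / p))" .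
    have "ennreal v * emeasure \<mu> Q * ennreal (s powr e) \<le> ennreal (K * C1 powr q)"
    proof (cases "s = 0")
      \<comment> \<open>\<open>0 powr e = 0\<close>, and the product is 0 even where \<mu> of the
        box is infinite.\<close>
      case True
      then show ?thesis by simp
    next
      case False
      then have s: "0 < s" using s0 by simp
      \<comment> \<open>\<open>e = q - q / p\<close>: the first power completes the left side of
        \<open>main\<close>, the second cancels the mass on its right side.\<close>
      have e1: "s powr e = s powr q * s powr - (q / p)"
        using s p by (simp add: e_def powr_add[symmetric] field_simps)
      have e2: "s powr (q / p) * s powr - (q / p) = 1" using s by (simp add: powr_add[symmetric])
      have vK: "v \<le> K * h powr (- \<beta> * q)" using K(2)[OF ab] by (simp add: v_def h_def Q_def)
      have "ennreal v * emeasure \<mu> Q * ennreal (s powr e)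
          \<le> ennreal (K * h powr (- \<beta> * q)) * emeasure \<mu> Q * ennreal (s powr e)"
        by (intro mult_right_mono ennreal_leI vK) auto
      also have "\<dots> = ennreal K * (ennreal (h powr (- \<beta> * q) * s powr q) * emeasure \<mu> Q) * ennreal (s powr - (q / p))"
        using K(1) by (simp add: e1 ennreal_mult mult_ac)
      also have "\<dots> \<le> ennreal K * ennreal (C1 powr q * s powr (q / p)) * ennreal (s powr - (q / p))"
        by (intro mult_right_mono mult_left_mono main) auto
      also have "\<dots> = ennreal (K * C1 powr q * (s powr (q / p) * s powr - (q / p)))"
        using K(1) by (simp add: ennreal_mult mult_ac)
      also have "\<dots> = ennreal (K * C1 powr q)" by (simp only: e2 mult_1_right)
      finally show ?thesis .
    qed
    then show "ennreal (enn2real (emeasure (Valpha \<alpha>) (Qbox a b)) powr (- q * (1 - \<gamma> / (2 + \<alpha>))))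
      * emeasure \<mu> (Qbox a b) * epowr (wmeas \<sigma> \<alpha> (Qbox a b)) e \<le> ennreal (K * C1 powr q)"
      using s0 by (simp add: v_def Q_def[symmetric] wmeas_eq[OF w] es)
  qed
  also have "\<dots> < \<infinity>" by simp
  finally show ?thesis .
qed

theorem theorem2p5:
  fixes \<alpha> p q \<gamma> :: real
  assumes "\<alpha> > -1" and "1 < p" and "p \<le> q" and "0 \<le> \<gamma>" and "\<gamma> < 2 + \<alpha>"
  shows "(\<forall>(\<sigma> :: complex \<Rightarrow> real) (\<mu> :: complex measure).
            is_weight \<sigma> \<and> sets \<mu> = sets (restrict_space borel UHP) \<and> in_Binf \<sigma> \<alpha> \<longrightarrow>
            ((\<exists>C1 > 0. \<forall>f. in_Lp p \<sigma> \<alpha> f \<longrightarrow>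
                 Mnorm_mu \<mu> q \<alpha> \<gamma> (wmul \<sigma> f) \<le> ennreal C1 * wnorm p \<sigma> \<alpha> f)
             \<longleftrightarrow> sigma_mu_const \<sigma> \<mu> p q \<alpha> \<gamma> < \<infinity>))
       \<and> (\<exists>C > 0. \<forall>(\<sigma> :: complex \<Rightarrow> real) (\<mu> :: complex measure) f.
            is_weight \<sigma> \<and> sets \<mu> = sets (restrict_space borel UHP) \<and> in_Binf \<sigma> \<alpha> \<and>
            in_Lp p \<sigma> \<alpha> f \<longrightarrow>
            Mnorm_mu \<mu> q \<alpha> \<gamma> (wmul \<sigma> f)
              \<le> ennreal C * epowr (sigma_mu_const \<sigma> \<mu> p q \<alpha> \<gamma>) (1 / q)
                 * epowr (Binf_const \<sigma> \<alpha>) (1 / p) * wnorm p \<sigma> \<alpha> f)"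
proof (intro conjI allI impI)
  show quant: "\<exists>C > 0. \<forall>(\<sigma> :: complex \<Rightarrow> real) (\<mu> :: complex measure) f.
            is_weight \<sigma> \<and> sets \<mu> = sets (restrict_space borel UHP) \<and> in_Binf \<sigma> \<alpha> \<and>
            in_Lp p \<sigma> \<alpha> f \<longrightarrow>
            Mnorm_mu \<mu> q \<alpha> \<gamma> (wmul \<sigma> f)
              \<le> ennreal C * epowr (sigma_mu_const \<sigma> \<mu> p q \<alpha> \<gamma>) (1 / q)
                 * epowr (Binf_const \<sigma> \<alpha>) (1 / p) * wnorm p \<sigma> \<alpha> f"
    by (rule Mnorm_mu_le) (use assms in auto)
  fix \<sigma> \<mu>
  assume *: "is_weight \<sigma> \<and> sets \<mu> = sets (restrict_space borel UHP) \<and> in_Binf \<sigma> \<alpha>"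
  show "(\<exists>C1 > 0. \<forall>f. in_Lp p \<sigma> \<alpha> f \<longrightarrow>
                 Mnorm_mu \<mu> q \<alpha> \<gamma> (wmul \<sigma> f) \<le> ennreal C1 * wnorm p \<sigma> \<alpha> f)
             \<longleftrightarrow> sigma_mu_const \<sigma> \<mu> p q \<alpha> \<gamma> < \<infinity>"
  proof
    assume "\<exists>C1 > 0. \<forall>f. in_Lp p \<sigma> \<alpha> f \<longrightarrow>
                 Mnorm_mu \<mu> q \<alpha> \<gamma> (wmul \<sigma> f) \<le> ennreal C1 * wnorm p \<sigma> \<alpha> f"
    then show "sigma_mu_const \<sigma> \<mu> p q \<alpha> \<gamma> < \<infinity>"
      using sigma_mu_const_finite[OF assms(1,2,3,5)] * by blast
  next
    assume fin: "sigma_mu_const \<sigma> \<mu> p q \<alpha> \<gamma> < \<infinity>"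
    obtain C where C: "C > 0" "\<And>f. in_Lp p \<sigma> \<alpha> f \<Longrightarrow>
            Mnorm_mu \<mu> q \<alpha> \<gamma> (wmul \<sigma> f)
              \<le> ennreal C * epowr (sigma_mu_const \<sigma> \<mu> p q \<alpha> \<gamma>) (1 / q)
                 * epowr (Binf_const \<sigma> \<alpha>) (1 / p) * wnorm p \<sigma> \<alpha> f"
      using quant * by blast
    define s where "s = enn2real (sigma_mu_const \<sigma> \<mu> p q \<alpha> \<gamma>)"
    define B where "B = enn2real (Binf_const \<sigma> \<alpha>)"
    have eq: "sigma_mu_const \<sigma> \<mu> p q \<alpha> \<gamma> = ennreal s" "Binf_const \<sigma> \<alpha> = ennreal B"
      using fin * by (simp_all add: s_def B_def in_Binf_def)
    have sB: "0 \<le> s" "0 \<le> B" by (simp_all add: s_def B_def)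
    \<comment> \<open>The summand 1 keeps the constant positive when \<open>s\<close> or
      \<open>B\<close> is 0.\<close>
    have "Mnorm_mu \<mu> q \<alpha> \<gamma> (wmul \<sigma> f)
        \<le> ennreal (C * s powr (1 / q) * B powr (1 / p) + 1) * wnorm p \<sigma> \<alpha> f" if "in_Lp p \<sigma> \<alpha> f" for f
    proof -
      have "Mnorm_mu \<mu> q \<alpha> \<gamma> (wmul \<sigma> f) \<le> ennreal (C * s powr (1 / q) * B powr (1 / p)) * wnorm p \<sigma> \<alpha> f"
        using C(2)[OF that] C(1) sB by (simp add: eq ennreal_mult)
      also have "\<dots> \<le> ennreal (C * s powr (1 / q) * B powr (1 / p) + 1) * wnorm p \<sigma> \<alpha> f"
        by (intro mult_right_mono ennreal_leI) auto
      finally show ?thesis .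
    qed
    moreover have "C * s powr (1 / q) * B powr (1 / p) + 1 > 0" using C(1) by (simp add: add_nonneg_pos)
    ultimately show "\<exists>C1 > 0. \<forall>f. in_Lp p \<sigma> \<alpha> f \<longrightarrow>
                 Mnorm_mu \<mu> q \<alpha> \<gamma> (wmul \<sigma> f) \<le> ennreal C1 * wnorm p \<sigma> \<alpha> f"
      by blast
  qed
qed

end
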